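(* Let $\mathcal F:\mathcal P_2(\mathbb R^d)\to\mathbb R\cup\{+\infty\}$ be $\lambda$-convex along generalized geodesics for some $\lambda\in\mathbb R$, and lower semicontinuous along sequences of $\mathcal P_2(\mathbb R^d)$ that converge narrowly and have uniformly bounded second moments. Let $\alpha>0$ and $0<\tau<\frac1{\lambda_-}$. Assume that there exists $\nu_0\in\mathcal P_2(\mathbb R^d)$ with $\mathcal F(\nu_0)$ and $H(\nu_0)$ finite. Then, for all $\mu\in\mathcal P_2(\mathbb R^d)$ with finite entropy $H(\mu)$, the functional $$\rho\in\mathcal P_2(\mathbb R^d)\longmapsto\frac{\mathrm{Sch}^{\alpha\tau}(\mu,\rho)}{\tau}+\mathcal F(\rho)$$ admits a minimizer $J^\alpha_\tau(\mu)\in\mathcal P_2(\mathbb R^d)$, and it has finite entropy.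
   Context: $\mathcal P_2(\mathbb R^d)$: Borel probability measures with finite second moment; narrow convergence is in duality with bounded continuous functions; $\lambda_-=\max(-\lambda,0)$, $1/0=+\infty$. Boltzmann entropy: for $\rho\in\mathcal P_2(\mathbb R^m)$, $H(\rho)=\int\rho\ln\rho\,dx$ if $\rho$ is absolutely continuous with respect to Lebesgue measure, $+\infty$ otherwise; well defined in $\mathbb R\cup\{+\infty\}$. Schrödinger cost: $\mathrm{Sch}^{\alpha\tau}(\mu,\nu)=\inf_{\gamma\in\Pi(\mu,\nu)}\{\int\frac{|x-y|^2}{2}d\gamma+\alpha\tau H(\gamma)+\frac{\alpha\tau d}{2}\ln(2\pi\alpha\tau)\}$, with $\Pi(\mu,\nu)$ the set of couplings and $H(\gamma)$ the Boltzmann entropy on $\mathbb R^{2d}$. $\lambda$-convexity along generalized geodesics: with $\pi_1,\pi_2,\pi_3:(\mathbb R^d)^3\to\mathbb R^d$ the canonical projections, for all $\mu,\nu,\rho\in\mathcal P_2(\mathbb R^d)$ and every $\Pi\in\mathcal P_2((\mathbb R^d)^3)$ such that $(\pi_1,\pi_2)_\#\Pi$ is an optimal (quadratic cost) transport plan between $\mu$ and $\nu$ and $(\pi_1,\pi_3)_\#\Pi$ is an optimal transport plan between $\mu$ and $\rho$, for all $t\in[0,1]$, $$\mathcal F((t\pi_3+(1-t)\pi_2)_\#\Pi)\le t\mathcal F(\rho)+(1-t)\mathcal F(\nu)-\tfrac\lambda2t(1-t)\int|y-z|^2\,d(\pi_2,\pi_3)_\#\Pi(y,z).$$ *)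

theory Defs
  imports "HOL-Probability.Probability"
begin

definition P2 :: "'a::euclidean_space measure set" where
  "P2 = {\<rho>. prob_space \<rho> \<and> sets \<rho> = sets borel \<and> integrable \<rho> (\<lambda>x. (norm x)\<^sup>2)}"

definition narrowly_converges ::
  "(nat \<Rightarrow> 'a::euclidean_space measure) \<Rightarrow> 'a measure \<Rightarrow> bool" where
  "narrowly_converges \<rho>s \<rho> \<longleftrightarrow>
     (\<forall>f :: 'a \<Rightarrow> real. continuous_on UNIV f \<and> bounded (range f) \<longrightarrow>
        (\<lambda>n. \<integral>x. f x \<partial>(\<rho>s n)) \<longlonglongrightarrow> (\<integral>x. f x \<partial>\<rho>))"

definition lsc_narrow_bounded_moments ::
  "('a::euclidean_space measure \<Rightarrow> ereal) \<Rightarrow> bool" where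
  "lsc_narrow_bounded_moments F \<longleftrightarrow>
     (\<forall>\<rho>s \<rho>. (\<forall>n. \<rho>s n \<in> P2) \<and> \<rho> \<in> P2 \<and> narrowly_converges \<rho>s \<rho> \<and>
        (\<exists>C. \<forall>n. (\<integral>x. (norm x)\<^sup>2 \<partial>(\<rho>s n)) \<le> C) \<longrightarrow>
        F \<rho> \<le> liminf (\<lambda>n. F (\<rho>s n)))"

text \<open>The integral of an extended-real valued quantity, as positive part minus negative part.
  For a measure in \<^const>\<open>P2\<close> the negative part of the entropy integrand has finite integral, so
  the difference is never of the form infinity minus infinity. Since \<open>ln 0 = 0\<close>, the integrand
  vanishes where the density does.\<close>

definition boltzmann_entropy :: "'a::euclidean_space measure \<Rightarrow> ereal" where
  "boltzmann_entropy \<rho> =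
     (if absolutely_continuous lborel \<rho> then
        (let f = (\<lambda>x. enn2real (RN_deriv lborel \<rho> x)) in
          enn2ereal (\<integral>\<^sup>+x. ennreal (f x * ln (f x)) \<partial>lborel)
          - enn2ereal (\<integral>\<^sup>+x. ennreal (- (f x * ln (f x))) \<partial>lborel))
      else \<infinity>)"

definition couplings ::
  "'a::euclidean_space measure \<Rightarrow> 'a measure \<Rightarrow> ('a \<times> 'a) measure set" where
  "couplings \<mu> \<nu> = {\<gamma>. prob_space \<gamma> \<and> sets \<gamma> = sets borel \<and>
                        distr \<gamma> borel fst = \<mu> \<and> distr \<gamma> borel snd = \<nu>}"

text \<open>Quadratic costs are Bochner integrals: they are only used for plans with marginals in
  \<^const>\<open>P2\<close>, for which the integrand is integrable.\<close>

definition optimal_plan ::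
  "'a::euclidean_space measure \<Rightarrow> 'a measure \<Rightarrow> ('a \<times> 'a) measure \<Rightarrow> bool" where
  "optimal_plan \<mu> \<nu> \<gamma> \<longleftrightarrow> \<gamma> \<in> couplings \<mu> \<nu> \<and>
     (\<forall>\<gamma>' \<in> couplings \<mu> \<nu>.
        (\<integral>(x, y). (norm (x - y))\<^sup>2 \<partial>\<gamma>) \<le> (\<integral>(x, y). (norm (x - y))\<^sup>2 \<partial>\<gamma>'))"

text \<open>The product type carries the Euclidean norm and \<^const>\<open>lborel\<close> on it is the product
  Lebesgue measure, so the entropy of a plan is the one on the space of doubled dimension.
  The first argument of the cost stands for \<open>\<alpha>\<tau>\<close>.\<close>

definition schroedinger_cost ::
  "real \<Rightarrow> 'a::euclidean_space measure \<Rightarrow> 'a measure \<Rightarrow> ereal" where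
  "schroedinger_cost \<epsilon> \<mu> \<nu> =
     (INF \<gamma> \<in> couplings \<mu> \<nu>.
        ereal (\<integral>(x, y). (norm (x - y))\<^sup>2 / 2 \<partial>\<gamma>)
        + ereal \<epsilon> * boltzmann_entropy \<gamma>
        + ereal (\<epsilon> * real DIM('a) / 2 * ln (2 * pi * \<epsilon>)))"

text \<open>In \<^typ>\<open>ereal\<close> one has \<open>0 * \<infinity> = 0\<close>, so the inequality is trivial at \<open>t = 0\<close> and \<open>t = 1\<close>.\<close>

definition convex_along_generalized_geodesics ::
  "real \<Rightarrow> ('a::euclidean_space measure \<Rightarrow> ereal) \<Rightarrow> bool" where
  "convex_along_generalized_geodesics l F \<longleftrightarrow>
     (\<forall>\<mu> \<in> P2. \<forall>\<nu> \<in> P2. \<forall>\<rho> \<in> P2. \<forall>\<Gamma> \<in> (P2 :: ('a \<times> 'a \<times> 'a) measure set).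
        optimal_plan \<mu> \<nu> (distr \<Gamma> borel (\<lambda>(x, y, z). (x, y))) \<and>
        optimal_plan \<mu> \<rho> (distr \<Gamma> borel (\<lambda>(x, y, z). (x, z))) \<longrightarrow>
        (\<forall>t \<in> {0..1}.
           F (distr \<Gamma> borel (\<lambda>(x, y, z). t *\<^sub>R z + (1 - t) *\<^sub>R y))
           \<le> ereal t * F \<rho> + ereal (1 - t) * F \<nu>
             - ereal (l / 2 * t * (1 - t) *
                 (\<integral>(y, z). (norm (y - z))\<^sup>2 \<partial>(distr \<Gamma> borel (\<lambda>(x, y, z). (y, z)))))))"

end

theory Submission
  imports Defs "HOL-Complex_Analysis.Great_Picard"
begin

text \<open>The functional is minimised over all plans with first marginal \<open>\<mu>\<close>. Taking a Dirac mass as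
  base point, generalized geodesic convexity is convexity along every coupling, which together with
  lower semicontinuity at the reference point yields a quadratic lower bound for \<open>F\<close>; as
  \<open>\<tau> < 1 / \<lambda>\<^sub>-\<close>, the second moments along a minimising sequence stay bounded. The entropies,
  taken relative to a Gaussian, are bounded as well, so the plans are uniformly absolutely continuous
  and a subsequence converges setwise. Hence no compactness theorem of Prokhorov type is needed: the
  marginal constraint passes to the limit trivially, and each of cost, entropy (a supremum of
  functionals that are continuous for setwise convergence) and \<open>F\<close> is lower semicontinuous.\<close>

section \<open>Setwise convergence of probability measures\<close>

text \<open>The Boltzmann entropy is not bounded below on \<open>P2\<close>; its negative part is
  controlled only by second moments. Writing it relative to the Gaussian weight with exponent
  \<open>\<delta>\<close> borrows \<open>\<delta>\<close> times the second moment of the plan. This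
  debt is moved into the cost integrand, where part of the quadratic cost pays it: minus a second
  moment is not lower semicontinuous by itself, whereas the combined integrand is nonnegative and
  Fatou's lemma applies. The strict inequality for \<open>\<tau>\<close> leaves something to pay
  with: the quadratic cost has coefficient \<open>1 / (2 * \<tau>)\<close>, while \<open>F\<close>
  is bounded below by minus any coefficient above \<open>max (- l) 0 / 2\<close> times the second
  moment, and the gap is shared among all the losses.

  Minimising over plans together with their second marginals handles the infimum in the Schroedinger
  cost and the minimisation over \<open>\<rho>\<close> at once. The entropy of the minimizer is then
  read off from the plan, since projecting cannot turn a finite entropy relative to a finite
  reference into an infinite one.\<close>

definition setwise_converges :: "(nat \<Rightarrow> 'a::topological_space measure) \<Rightarrow> 'a measure \<Rightarrow> bool" where
  "setwise_converges M N \<longleftrightarrow> (\<forall>A \<in> sets borel. (\<lambda>n. measure (M n) A) \<longlonglongrightarrow> measure N A)"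

text \<open>Diagonal extraction reaches only countably many sets, and Dynkin's theorem extends a
  property only from a generator closed under intersections. The finite intersections of a countable
  base meet both demands.\<close>

lemma countable_Int_stable_generator_borel:
  obtains G :: "'a::second_countable_topology set set"
  where "countable G" "Int_stable G" "sigma_sets UNIV G = sets borel"
proof -
  obtain B :: "'a set set" where B: "countable B" "topological_basis B"
    using ex_countable_basis by blast
  define G where "G = Inter ` {F. finite F \<and> F \<subseteq> B}"
  have "countable G"
    unfolding G_def using countable_Collect_finite_subset[OF B(1)] by blast
  moreover have "Int_stable G"
  proof (rule Int_stableI)
    fix a b assume "a \<in> G" "b \<in> G"
    then obtain F F' where "finite F" "F \<subseteq> B" "a = \<Inter>F" "finite F'" "F' \<subseteq> B" "b = \<Inter>F'"
      by (auto simp: G_def)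
    then have "a \<inter> b = \<Inter>(F \<union> F')" "finite (F \<union> F')" "F \<union> F' \<subseteq> B" by auto
    then show "a \<inter> b \<in> G" unfolding G_def by blast
  qed
  moreover have "sigma_sets UNIV G = sets borel"
  proof
    have "G \<subseteq> sets borel"
    proof
      fix a assume "a \<in> G"
      then obtain F where F: "finite F" "F \<subseteq> B" "a = \<Inter>F" by (auto simp: G_def)
      have "open a" using F B(2) by (auto intro!: open_Inter simp: topological_basis_open)
      then show "a \<in> sets borel" by simp
    qed
    then show "sigma_sets UNIV G \<subseteq> sets borel"
      using sets.sigma_sets_subset[of G borel] by simp
    have "B \<subseteq> G"
    proof
      fix b assume "b \<in> B"
      then have "b = \<Inter>{b}" "finite {b}" "{b} \<subseteq> B" by auto
      then show "b \<in> G" unfolding G_def by blast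
    qed
    then have "sigma_sets UNIV B \<subseteq> sigma_sets UNIV G"
      by (rule sigma_sets_mono')
    moreover have "sets borel = sigma_sets UNIV B"
      by (subst borel_eq_countable_basis[OF B]) (simp add: sets_measure_of)
    ultimately show "sets borel \<subseteq> sigma_sets UNIV G" by simp
  qed
  ultimately show thesis using that by blast
qed

text \<open>Serves countable disjoint unions: the finite partial sums converge and approximate the
  measure of the union uniformly along the sequence, so the Cauchy property is inherited.\<close>

lemma convergent_if_uniformly_close:
  fixes a :: "nat \<Rightarrow> real"
  assumes "\<And>\<epsilon>. \<epsilon> > 0 \<Longrightarrow> \<exists>b. convergent b \<and> (\<forall>n. \<bar>a n - b n\<bar> \<le> \<epsilon>)"
  shows "convergent a"
proof -
  have "Cauchy a"
  proof (rule CauchyI)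
    fix e :: real assume "e > 0"
    then obtain b where b: "convergent b" "\<And>n. \<bar>a n - b n\<bar> \<le> e/4"
      using assms[of "e/4"] by auto
    obtain N where N: "\<And>m n. m \<ge> N \<Longrightarrow> n \<ge> N \<Longrightarrow> \<bar>b m - b n\<bar> < e/4"
      using CauchyD[OF convergent_Cauchy[OF b(1)], of "e/4"] \<open>e > 0\<close> by auto
    show "\<exists>M. \<forall>m\<ge>M. \<forall>n\<ge>M. norm (a m - a n) < e"
    proof (intro exI allI impI)
      fix m n assume "m \<ge> N" "n \<ge> N"
      then show "norm (a m - a n) < e"
        using N[of m n] b(2)[of m] b(2)[of n] \<open>e > 0\<close> unfolding real_norm_def by linarith
    qed
  qed
  then show ?thesis by (simp add: Cauchy_convergent_iff)
qed

lemma (in finite_measure) measure_decseq_empty: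
  assumes "range A \<subseteq> sets M" "decseq A" "(\<Inter>i. A i) = {}"
  shows "(\<lambda>i. measure M (A i)) \<longlonglongrightarrow> 0"
  using finite_Lim_measure_decseq[OF assms(1,2)] assms(3) by simp

text \<open>The Vitali--Hahn--Saks situation, where uniform absolute continuity is given beforehand.\<close>

lemma setwise_convergent_subsequence:
  fixes Q :: "'a::second_countable_topology measure" and M :: "nat \<Rightarrow> 'a measure"
  assumes Q: "finite_measure Q" "sets Q = sets borel"
    and M: "\<And>n. prob_space (M n)" "\<And>n. sets (M n) = sets borel"
    and ac: "\<And>\<epsilon>. \<epsilon> > 0 \<Longrightarrow> \<exists>\<delta>>0. \<forall>A \<in> sets borel. measure Q A < \<delta> \<longrightarrow> (\<forall>n. measure (M n) A \<le> \<epsilon>)"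
  obtains r N where "strict_mono (r :: nat \<Rightarrow> nat)" "prob_space N" "sets N = sets borel"
    "setwise_converges (M \<circ> r) N"
proof -
  interpret Q: finite_measure Q by fact
  have sp: "space (M n) = UNIV" for n
    using sets_eq_imp_space_eq[OF M(2)] by simp
  have pM: "0 \<le> measure (M n) A" "measure (M n) A \<le> 1" for n A
    using prob_space.prob_le_1[OF M(1)] by auto
  obtain G :: "'a set set" where G: "countable G" "Int_stable G" "sigma_sets UNIV G = sets borel"
    using countable_Int_stable_generator_borel by blast
  obtain r where r: "strict_mono (r :: nat \<Rightarrow> nat)"
    and conv_G: "\<And>A. A \<in> G \<Longrightarrow> \<exists>l. (\<lambda>n. measure (M (r n)) A) \<longlonglongrightarrow> l"
    using function_convergent_subsequence[OF G(1), of "\<lambda>n A. measure (M n) A" 1] pM by auto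
  \<comment> \<open>Here uniform absolute continuity enters: along sets decreasing to the empty set
    the measures become small uniformly in \<open>n\<close>. This serves twice, for the tails of
    disjoint unions and for countable additivity of the limit.\<close>
  have small: "\<exists>k. \<forall>n. measure (M n) (A k) \<le> \<epsilon>"
    if A: "range A \<subseteq> sets borel" "decseq A" "(\<Inter>i. A i) = {}" and "\<epsilon> > 0"
    for A :: "nat \<Rightarrow> 'a set" and \<epsilon> :: real
  proof -
    obtain \<delta> where d: "\<delta> > 0" "\<And>A n. A \<in> sets borel \<Longrightarrow> measure Q A < \<delta> \<Longrightarrow> measure (M n) A \<le> \<epsilon>"
      using ac[OF \<open>\<epsilon> > 0\<close>] by blast
    have "(\<lambda>i. measure Q (A i)) \<longlonglongrightarrow> 0"
      using Q.measure_decseq_empty[of A] A Q(2) by simp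
    from order_tendstoD(2)[OF this d(1)] obtain k where "measure Q (A k) < \<delta>"
      using eventually_happens by fastforce
    then show ?thesis using d(2)[of "A k"] A(1) by blast
  qed
  have conv: "convergent (\<lambda>n. measure (M (r n)) A)" if "A \<in> sets borel" for A
  proof -
    have "A \<in> sigma_sets UNIV G" using that G(3) by simp
    \<comment> \<open>Dynkin's argument: convergence holds on \<open>G\<close> and passes to
      complements, as all masses are 1, and to countable disjoint unions.\<close>
    from G(2) subset_UNIV[of G, folded Pow_UNIV] this show ?thesis
    proof (induction rule: sigma_sets_induct_disjoint)
      case (basic A)
      then show ?case using conv_G by (auto simp: convergent_def)
    next
      case empty
      show ?case by (simp add: convergent_const)
    next
      case (compl A)
      have A: "A \<in> sets borel" using compl(1) G(3) by simp
      then have "measure (M (r n)) (UNIV - A) = 1 - measure (M (r n)) A" for n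
        using prob_space.prob_compl[OF M(1), of A "r n"] A sp M(2) by simp
      then show ?case using convergent_diff[OF convergent_const compl(2), of 1] by simp
    next
      case (union A)
      have A: "range A \<subseteq> sets borel" using union(2) G(3) by simp
      \<comment> \<open>The tails decrease to the empty set because a point of \<open>A i\<close>
        lies in no later member of the family. Hence \<open>small\<close> makes the error of the
        partial sum over \<open>i < k\<close> uniform in \<open>n\<close>.\<close>
      define T where "T k = (\<Union>i. A (i + k))" for k
      have T: "T k \<in> sets borel" for k
        unfolding T_def using A by auto
      have "decseq T"
      proof (rule decseq_SucI)
        fix k
        have "A (i + Suc k) = A (Suc i + k)" for i by simp
        then show "T (Suc k) \<le> T k" unfolding T_def by blast
      qed
      moreover have "(\<Inter>k. T k) = {}"
      proof -
        have False if "x \<in> (\<Inter>k. T k)" for x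
        proof -
          have "x \<in> T 0" using that by blast
          then obtain i where i: "x \<in> A i" unfolding T_def by blast
          have "x \<in> T (Suc i)" using that by blast
          then obtain j where "x \<in> A (j + Suc i)" unfolding T_def by blast
          moreover have "A i \<inter> A (j + Suc i) = {}"
            using union(1) by (auto simp: disjoint_family_on_def)
          ultimately show False using i by blast
        qed
        then show ?thesis by blast
      qed
      ultimately have sm: "\<exists>k. \<forall>n. measure (M n) (T k) \<le> \<epsilon>" if "\<epsilon> > 0" for \<epsilon>
        using small[of T \<epsilon>] T that by blast
      show ?case
      proof (rule convergent_if_uniformly_close)
        fix \<epsilon> :: real assume "\<epsilon> > 0"
        then obtain k where k: "\<And>n. measure (M n) (T k) \<le> \<epsilon>" using sm by blast
        define b where "b n = (\<Sum>i<k. measure (M (r n)) (A i))" for n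
        have cb: "convergent b" unfolding b_def
          using union(3) by (intro convergent_sum) auto
        have "measure (M (r n)) (\<Union>i. A i) = b n + measure (M (r n)) (T k)" for n
        proof -
          interpret prob_space "M (r n)" by (rule M)
          have "(\<Union>i. A i) = (\<Union>i<k. A i) \<union> T k"
          proof -
            have "x \<in> (\<Union>i<k. A i) \<union> T k" if "x \<in> A i" for x i
            proof (cases "i < k")
              case False
              then have "A i = A ((i - k) + k)" by simp
              then show ?thesis using that unfolding T_def by blast
            qed (use that in auto)
            moreover have "T k \<subseteq> (\<Union>i. A i)" unfolding T_def by blast
            ultimately show ?thesis by blast
          qed
          moreover have "(\<Union>i<k. A i) \<inter> T k = {}"
          proof -
            have "A i \<inter> A (j + k) = {}" if "i < k" for i j
              using union(1) that by (auto simp: disjoint_family_on_def)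
            then show ?thesis unfolding T_def by blast
          qed
          moreover have "measure (M (r n)) (\<Union>i<k. A i) = b n"
            unfolding b_def using A union(1) M(2)
            by (intro finite_measure_finite_Union) (auto intro: disjoint_family_on_mono)
          ultimately show ?thesis
            using finite_measure_Union[of "\<Union>i<k. A i" "T k"] A T M(2) by auto
        qed
        then have "\<forall>n. \<bar>measure (M (r n)) (\<Union>i. A i) - b n\<bar> \<le> \<epsilon>" using k by simp
        with cb show "\<exists>b. convergent b \<and> (\<forall>n. \<bar>measure (M (r n)) (\<Union>i. A i) - b n\<bar> \<le> \<epsilon>)"
          by blast
      qed
    qed
  qed
  define m where "m A = lim (\<lambda>n. measure (M (r n)) A)" for A
  have m: "(\<lambda>n. measure (M (r n)) A) \<longlonglongrightarrow> m A" if "A \<in> sets borel" for A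
    using conv[OF that] unfolding m_def by (simp add: convergent_LIMSEQ_iff)
  have m0: "0 \<le> m A" if "A \<in> sets borel" for A
    by (rule LIMSEQ_le_const[OF m[OF that]]) simp
  have m_le: "m A \<le> \<epsilon>" if "A \<in> sets borel" "\<And>n. measure (M n) A \<le> \<epsilon>" for A \<epsilon>
    by (rule LIMSEQ_le_const2[OF m[OF that(1)]]) (use that in auto)
  have "m {} = 0"
    by (rule LIMSEQ_unique[OF m[of "{}"]]) simp_all
  have add: "m (A \<union> B) = m A + m B" if "A \<in> sets borel" "B \<in> sets borel" "A \<inter> B = {}" for A B
  proof -
    have "measure (M (r n)) (A \<union> B) = measure (M (r n)) A + measure (M (r n)) B" for n
    proof -
      interpret prob_space "M (r n)" by (rule M)
      show ?thesis using that M(2) by (intro finite_measure_Union) auto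
    qed
    then have "(\<lambda>n. measure (M (r n)) (A \<union> B)) \<longlonglongrightarrow> m A + m B"
      using tendsto_add[OF m[OF that(1)] m[OF that(2)]] by simp
    then show ?thesis
      using that by (intro LIMSEQ_unique[OF m[of "A \<union> B"]]) simp_all
  qed
  define N where "N = measure_of UNIV (sets borel) (\<lambda>A. ennreal (m A))"
  have sa: "sigma_algebra UNIV (sets (borel :: 'a measure))"
    using sets.sigma_algebra_axioms[of "borel :: 'a measure"] by simp
  have sN: "sets N = sets borel"
    unfolding N_def using sigma_algebra.sets_measure_of_eq[OF sa] by simp
  have pos: "positive (sets borel) (\<lambda>A. ennreal (m A))"
    using \<open>m {} = 0\<close> by (simp add: positive_def)
  \<comment> \<open>Finite additivity of \<open>m\<close> is inherited from the measures; continuity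
    at the empty set, again from \<open>small\<close>, upgrades it to countable additivity.\<close>
  have ca: "countably_additive (sets borel) (\<lambda>A. ennreal (m A))"
  proof (rule ring_of_sets.empty_continuous_imp_countably_additive)
    show "ring_of_sets UNIV (sets (borel :: 'a measure))"
      using sa by (simp add: sigma_algebra_def algebra_def)
    show "positive (sets borel) (\<lambda>A. ennreal (m A))" by fact
    show "additive (sets borel) (\<lambda>A. ennreal (m A))"
      using add m0 by (auto simp: additive_def ennreal_plus[symmetric] simp del: ennreal_plus)
    fix A :: "nat \<Rightarrow> 'a set"
    assume A: "range A \<subseteq> sets borel" "decseq A" "(\<Inter>i. A i) = {}"
    have mono: "m (A j) \<le> m (A i)" if "i \<le> j" for i j
    proof (rule LIMSEQ_le[OF m m])
      have "measure (M (r n)) (A j) \<le> measure (M (r n)) (A i)" for n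
      proof -
        interpret prob_space "M (r n)" by (rule M)
        show ?thesis using A that M(2) by (intro finite_measure_mono) (auto dest: decseqD)
      qed
      then show "\<exists>N. \<forall>n\<ge>N. measure (M (r n)) (A j) \<le> measure (M (r n)) (A i)" by blast
    qed (use A in auto)
    have "(\<lambda>i. m (A i)) \<longlonglongrightarrow> 0"
    proof (rule LIMSEQ_I)
      fix e :: real assume "e > 0"
      then obtain k where k: "\<And>n. measure (M n) (A k) \<le> e/2"
        using small[OF A, of "e/2"] by auto
      then have "m (A k) \<le> e/2" using A(1) by (intro m_le) auto
      then have "norm (m (A n) - 0) < e" if "n \<ge> k" for n
        using mono[OF that] m0[of "A n"] A(1) \<open>e > 0\<close> by auto
      then show "\<exists>k. \<forall>n\<ge>k. norm (m (A n) - 0) < e" by blast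
    qed
    then show "(\<lambda>i. ennreal (m (A i))) \<longlonglongrightarrow> 0"
      using tendsto_ennrealI[of "\<lambda>i. m (A i)" 0] by simp
  qed simp
  have eN: "emeasure N A = ennreal (m A)" if "A \<in> sets borel" for A
    using emeasure_measure_of_sigma[OF sa pos ca that] unfolding N_def .
  have mN: "measure N A = m A" if "A \<in> sets borel" for A
    using eN[OF that] m0[OF that] by (simp add: measure_def)
  have "m UNIV = 1"
  proof -
    have "measure (M (r n)) UNIV = 1" for n
      using prob_space.prob_space[OF M(1), of "r n"] sp by simp
    then show ?thesis by (intro LIMSEQ_unique[OF m[of UNIV]]) simp_all
  qed
  then have "prob_space N"
    using eN[of UNIV] sets_eq_imp_space_eq[OF sN] by (intro prob_spaceI) simp
  moreover have "setwise_converges (M \<circ> r) N"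
    unfolding setwise_converges_def using m mN by simp
  ultimately show thesis using that r sN by blast
qed

section \<open>Integrals under setwise convergence\<close>

lemma setwise_Fatou:
  fixes u :: "'a::topological_space \<Rightarrow> ennreal"
  assumes M: "\<And>n. prob_space (M n)" "\<And>n. sets (M n) = sets borel"
    and N: "prob_space N" "sets N = sets borel"
    and conv: "setwise_converges M N" and u: "u \<in> borel_measurable borel"
  shows "(\<integral>\<^sup>+x. u x \<partial>N) \<le> liminf (\<lambda>n. \<integral>\<^sup>+x. u x \<partial>M n)"
  unfolding nn_integral_def_finite[of N]
proof (rule SUP_least)
  \<comment> \<open>It suffices to test with simple functions below \<open>u\<close>, whose
    integrals are finite sums of values of the measures and so converge. Restricting to
    finite-valued \<open>g\<close> makes multiplication by its values continuous in
    \<open>ennreal\<close>.\<close>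
  fix g :: "'a \<Rightarrow> ennreal"
  assume "g \<in> {g. simple_function N g \<and> g \<le> u \<and> (\<forall>x. g x < top)}"
  then have g: "simple_function N g" "g \<le> u" "\<And>x. g x < top" by auto
  have sp: "space (M n) = UNIV" "space N = UNIV" for n
    using sets_eq_imp_space_eq[OF M(2)] sets_eq_imp_space_eq[OF N(2)] by simp_all
  have "simple_function N g \<longleftrightarrow> simple_function borel g"
    by (rule simple_function_cong_algebra) (simp_all add: N sp)
  then have gb: "simple_function borel g" using g(1) by simp
  have "simple_function (M n) g \<longleftrightarrow> simple_function borel g" for n
    by (rule simple_function_cong_algebra) (simp_all add: M sp)
  then have gM: "simple_function (M n) g" for n using gb by simp
  have mes: "g -` {y} \<in> sets borel" for y
    using simple_functionD(2)[OF gb, of "{y}"] by simp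
  have e: "(\<lambda>n. emeasure (M n) A) \<longlonglongrightarrow> emeasure N A" if "A \<in> sets borel" for A
  proof -
    have "emeasure (M n) A = ennreal (measure (M n) A)" for n
      using finite_measure.emeasure_eq_measure[OF prob_space.finite_measure[OF M(1)]] .
    moreover have "emeasure N A = ennreal (measure N A)"
      using finite_measure.emeasure_eq_measure[OF prob_space.finite_measure[OF N(1)]] .
    ultimately show ?thesis
      using conv that tendsto_ennrealI by (auto simp: setwise_converges_def)
  qed
  have "(\<lambda>n. integral\<^sup>S (M n) g) \<longlonglongrightarrow> integral\<^sup>S N g"
    unfolding simple_integral_def sp
    using g(3) mes by (intro tendsto_sum ennreal_tendsto_cmult e) auto
  then have "integral\<^sup>S N g = liminf (\<lambda>n. integral\<^sup>S (M n) g)"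
    by (intro lim_imp_Liminf[symmetric]) auto
  also have "\<dots> \<le> liminf (\<lambda>n. \<integral>\<^sup>+x. u x \<partial>M n)"
  proof (intro Liminf_mono always_eventually allI)
    fix n
    have "integral\<^sup>S (M n) g = (\<integral>\<^sup>+x. g x \<partial>M n)" by (simp add: nn_integral_eq_simple_integral gM)
    also have "\<dots> \<le> (\<integral>\<^sup>+x. u x \<partial>M n)" using g(2) by (intro nn_integral_mono) (auto simp: le_fun_def)
    finally show "integral\<^sup>S (M n) g \<le> (\<integral>\<^sup>+x. u x \<partial>M n)" .
  qed
  finally show "integral\<^sup>S N g \<le> liminf (\<lambda>n. \<integral>\<^sup>+x. u x \<partial>M n)" .
qed

lemma liminf_enn2ereal:
  "liminf (\<lambda>n. enn2ereal (u n)) = enn2ereal (liminf u)"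
  by (rule Liminf_compose_continuous_mono)
    (auto simp: continuous_on_enn2ereal mono_def less_eq_ennreal.rep_eq)

text \<open>Fatou's lemma is for nonnegative functions; adding the bound \<open>B\<close> to
  \<open>f\<close> and to \<open>- f\<close> gives the two one-sided estimates. Unlike narrow
  convergence, setwise convergence thus reaches all bounded Borel integrands, which is what the test
  functions of the dual entropy are.\<close>

lemma setwise_integral_tendsto:
  fixes f :: "'a::topological_space \<Rightarrow> real"
  assumes M: "\<And>n. prob_space (M n)" "\<And>n. sets (M n) = sets borel"
    and N: "prob_space N" "sets N = sets borel"
    and conv: "setwise_converges M N"
    and f: "f \<in> borel_measurable borel" "\<And>x. \<bar>f x\<bar> \<le> B"
  shows "(\<lambda>n. \<integral>x. f x \<partial>M n) \<longlonglongrightarrow> (\<integral>x. f x \<partial>N)"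
proof -
  have int: "integrable P g" if "prob_space P" "sets P = sets borel" "g \<in> borel_measurable borel"
    "\<And>x. \<bar>g x\<bar> \<le> B" for P and g :: "'a \<Rightarrow> real"
  proof -
    interpret prob_space P by fact
    show ?thesis
      using that measurable_cong_sets[OF that(2) refl]
      by (intro integrable_const_bound[where B=B]) auto
  qed
  have lower: "(\<integral>x. g x \<partial>N) \<le> liminf (\<lambda>n. ereal (\<integral>x. g x \<partial>M n))"
    if g: "g \<in> borel_measurable borel" "\<And>x. \<bar>g x\<bar> \<le> B" for g :: "'a \<Rightarrow> real"
  proof -
    have pos: "0 \<le> g x + B" for x using g(2)[of x] by (auto simp: abs_le_iff)
    have eq: "(\<integral>\<^sup>+x. ennreal (g x + B) \<partial>P) = ennreal ((\<integral>x. g x \<partial>P) + B)" "0 \<le> (\<integral>x. g x \<partial>P) + B"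
      if P: "prob_space P" "sets P = sets borel" for P
    proof -
      interpret prob_space P by fact
      have i: "integrable P g" using int[OF P g] .
      have "(\<integral>x. g x + B \<partial>P) = (\<integral>x. g x \<partial>P) + B"
        using i by (simp add: prob_space)
      moreover have "integrable P (\<lambda>x. g x + B)" using i by simp
      then have "(\<integral>\<^sup>+x. ennreal (g x + B) \<partial>P) = ennreal (\<integral>x. g x + B \<partial>P)"
        using pos by (intro nn_integral_eq_integral) auto
      moreover have "0 \<le> (\<integral>x. g x + B \<partial>P)" using pos by (intro integral_nonneg_AE) auto
      ultimately show "0 \<le> (\<integral>x. g x \<partial>P) + B"
        "(\<integral>\<^sup>+x. ennreal (g x + B) \<partial>P) = ennreal ((\<integral>x. g x \<partial>P) + B)"
        by metis+
    qed
    have "ennreal ((\<integral>x. g x \<partial>N) + B) \<le> liminf (\<lambda>n. ennreal ((\<integral>x. g x \<partial>M n) + B))"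
      using setwise_Fatou[OF M N conv, of "\<lambda>x. ennreal (g x + B)"] g(1)
      by (simp add: eq(1)[OF M] eq(1)[OF N])
    then have "enn2ereal (ennreal ((\<integral>x. g x \<partial>N) + B)) \<le> enn2ereal (liminf (\<lambda>n. ennreal ((\<integral>x. g x \<partial>M n) + B)))"
      by (simp add: less_eq_ennreal.rep_eq)
    also have "\<dots> = liminf (\<lambda>n. enn2ereal (ennreal ((\<integral>x. g x \<partial>M n) + B)))"
      by (simp add: liminf_enn2ereal)
    finally have "ereal ((\<integral>x. g x \<partial>N) + B) \<le> liminf (\<lambda>n. ereal ((\<integral>x. g x \<partial>M n) + B))"
      by (simp add: eq(2)[OF M] eq(2)[OF N])
    also have "\<dots> = liminf (\<lambda>n. ereal (\<integral>x. g x \<partial>M n)) + ereal B"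
      using Liminf_add_ereal_right[of sequentially B "\<lambda>n. ereal (\<integral>x. g x \<partial>M n)"] by simp
    finally show ?thesis
      by (cases "liminf (\<lambda>n. ereal (\<integral>x. g x \<partial>M n))") auto
  qed
  have "ereal (\<integral>x. - f x \<partial>N) \<le> liminf (\<lambda>n. ereal (\<integral>x. - f x \<partial>M n))"
    using lower[of "\<lambda>x. - f x"] f by auto
  then have up: "limsup (\<lambda>n. ereal (\<integral>x. f x \<partial>M n)) \<le> ereal (\<integral>x. f x \<partial>N)"
    using ereal_Liminf_uminus[of sequentially "\<lambda>n. ereal (\<integral>x. f x \<partial>M n)"]
    by simp (metis ereal_minus_le_minus uminus_ereal.simps(1))
  show ?thesis
    by (rule limsup_le_liminf_real[OF up]) (use lower f in auto)
qed

section \<open>Relative entropy in dual form\<close>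

text \<open>The convex generator of relative entropy, shifted by an affine term so as to be
  nonnegative with its zero at 1. Its Legendre conjugate is \<open>exp t - 1\<close>, which
  therefore appears in the dual form. As \<open>ln 0 = 0\<close>, the value at 0 is the continuous
  extension 1.\<close>

definition entropy_fun :: "real \<Rightarrow> real" where
  "entropy_fun r = r * ln r - r + 1"

text \<open>The Fenchel-Young inequality, from \<open>ln u <= u - 1\<close> at
  \<open>u = exp t / s\<close>. Equality holds at \<open>t = ln s\<close>, which suggests the nearly
  optimal test functions used later.\<close>

lemma entropy_fun_Young:
  assumes "0 \<le> s"
  shows "s * t \<le> entropy_fun s + (exp t - 1)"
proof (cases "s = 0")
  case False
  then have s: "s > 0" using assms by simp
  have "ln (exp t / s) \<le> exp t / s - 1" using s by (intro ln_le_minus_one) simp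
  then have "t - ln s \<le> exp t / s - 1" using s by (simp add: ln_div)
  then have "s * (t - ln s) \<le> s * (exp t / s - 1)" using s by (intro mult_left_mono) auto
  also have "\<dots> = exp t - s" using s by (simp add: field_simps)
  finally show ?thesis by (simp add: entropy_fun_def algebra_simps)
qed (simp add: entropy_fun_def)

lemma entropy_fun_nonneg: "0 \<le> s \<Longrightarrow> 0 \<le> entropy_fun s"
  using entropy_fun_Young[of s 0] by simp

text \<open>The right side exceeds the left by exactly \<open>a + b\<close>. Each of its terms
  separates the variables once \<open>a\<close> and \<open>b\<close> are densities in different
  coordinates.\<close>

lemma entropy_fun_mult:
  assumes "0 \<le> a" "0 \<le> b"
  shows "entropy_fun (a * b) \<le> b * entropy_fun a + a * entropy_fun b + a * b + 1"
proof (cases "a = 0 \<or> b = 0")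
  case False
  then have "ln (a * b) = ln a + ln b" using assms by (simp add: ln_mult)
  then show ?thesis using assms by (simp add: entropy_fun_def algebra_simps)
qed (use assms in \<open>auto simp: entropy_fun_def\<close>)

lemma borel_measurable_entropy_fun [measurable]: "entropy_fun \<in> borel_measurable borel"
  unfolding entropy_fun_def[abs_def] by measurable

text \<open>The Legendre form of the relative entropy (Donsker--Varadhan, unnormalised): it makes lower
  semicontinuity under setwise convergence and monotonicity under projections immediate.\<close>

definition dual_entropy :: "'a::topological_space measure \<Rightarrow> 'a measure \<Rightarrow> ereal" where
  "dual_entropy Q N = (SUP \<phi> \<in> {\<phi>. \<phi> \<in> borel_measurable borel \<and> bounded (range \<phi>)}.
     ereal ((\<integral>x. \<phi> x \<partial>N) - (\<integral>x. exp (\<phi> x) - 1 \<partial>Q)))"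

lemma dual_entropy_upper:
  "\<phi> \<in> borel_measurable borel \<Longrightarrow> bounded (range \<phi>) \<Longrightarrow>
   ereal ((\<integral>x. \<phi> x \<partial>N) - (\<integral>x. exp (\<phi> x) - 1 \<partial>Q)) \<le> dual_entropy Q N"
  unfolding dual_entropy_def by (rule SUP_upper) auto

lemma dual_entropy_nonneg: "0 \<le> dual_entropy Q N"
  using dual_entropy_upper[of "\<lambda>_. 0" N Q] by (simp add: zero_ereal_def)

lemma integrable_bounded_borel:
  fixes f :: "'a::topological_space \<Rightarrow> real"
  assumes "finite_measure P" "sets P = sets borel" "f \<in> borel_measurable borel" "bounded (range f)"
  shows "integrable P f"
proof -
  obtain B where "\<And>x. norm (f x) \<le> B" using assms(4) by (auto simp: bounded_iff)
  then show ?thesis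
    using assms measurable_cong_sets[OF assms(2) refl]
    by (intro finite_measure.integrable_const_bound[OF assms(1), where B=B]) auto
qed

lemma bounded_range_exp:
  assumes "bounded (range (f :: 'a \<Rightarrow> real))" shows "bounded (range (\<lambda>x. exp (f x) - 1))"
proof -
  obtain B where B: "\<And>x. \<bar>f x\<bar> \<le> B" using assms by (auto simp: bounded_iff)
  have "norm (exp (f x) - 1) \<le> exp B + 1" for x
  proof -
    have "exp (f x) \<le> exp B" "0 < exp (f x)" using B[of x] by (auto simp: abs_le_iff)
    then show ?thesis unfolding real_norm_def by linarith
  qed
  then show ?thesis unfolding bounded_iff by blast
qed

lemma dual_entropy_lsc:
  assumes M: "\<And>n. prob_space (M n)" "\<And>n. sets (M n) = sets borel"
    and N: "prob_space N" "sets N = sets borel"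
    and conv: "setwise_converges M N"
  shows "dual_entropy Q N \<le> liminf (\<lambda>n. dual_entropy Q (M n))"
  unfolding dual_entropy_def[of Q N]
proof (rule SUP_least)
  fix \<phi> :: "'a \<Rightarrow> real" assume "\<phi> \<in> {\<phi>. \<phi> \<in> borel_measurable borel \<and> bounded (range \<phi>)}"
  then have p: "\<phi> \<in> borel_measurable borel" "bounded (range \<phi>)" by auto
  then obtain B where B: "\<And>x. \<bar>\<phi> x\<bar> \<le> B" by (auto simp: bounded_iff)
  have "(\<lambda>n. \<integral>x. \<phi> x \<partial>M n) \<longlonglongrightarrow> (\<integral>x. \<phi> x \<partial>N)"
    by (rule setwise_integral_tendsto[OF M N conv p(1) B])
  then have "(\<lambda>n. ereal ((\<integral>x. \<phi> x \<partial>M n) - (\<integral>x. exp (\<phi> x) - 1 \<partial>Q)))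
      \<longlonglongrightarrow> ereal ((\<integral>x. \<phi> x \<partial>N) - (\<integral>x. exp (\<phi> x) - 1 \<partial>Q))"
    by (intro tendsto_ereal tendsto_diff tendsto_const)
  then have "ereal ((\<integral>x. \<phi> x \<partial>N) - (\<integral>x. exp (\<phi> x) - 1 \<partial>Q))
      = liminf (\<lambda>n. ereal ((\<integral>x. \<phi> x \<partial>M n) - (\<integral>x. exp (\<phi> x) - 1 \<partial>Q)))"
    by (intro lim_imp_Liminf[symmetric]) auto
  also have "\<dots> \<le> liminf (\<lambda>n. dual_entropy Q (M n))"
    by (intro Liminf_mono always_eventually allI dual_entropy_upper p)
  finally show "ereal ((\<integral>x. \<phi> x \<partial>N) - (\<integral>x. exp (\<phi> x) - 1 \<partial>Q)) \<le> liminf (\<lambda>n. dual_entropy Q (M n))" .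
qed

text \<open>Test the supremum with \<open>t\<close> times the indicator of \<open>A\<close>.
  Dividing by a large \<open>t\<close> makes the entropy bound negligible, which yields absolute
  continuity as well as its uniformity on sublevel sets of the entropy.\<close>

lemma dual_entropy_measure_le:
  assumes Q: "finite_measure Q" "sets Q = sets borel"
    and N: "prob_space N" "sets N = sets borel"
    and K: "dual_entropy Q N \<le> ereal K" and A: "A \<in> sets borel"
  shows "t * measure N A \<le> K + (exp t - 1) * measure Q A"
proof -
  have sp: "space Q = UNIV" "space N = UNIV"
    using sets_eq_imp_space_eq[OF Q(2)] sets_eq_imp_space_eq[OF N(2)] by simp_all
  define \<phi> where "\<phi> x = t * indicator A x" for x :: 'a
  have p: "\<phi> \<in> borel_measurable borel" unfolding \<phi>_def using A by simp
  have b: "bounded (range \<phi>)"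
  proof -
    have "norm (\<phi> x) \<le> \<bar>t\<bar>" for x by (simp add: \<phi>_def abs_mult indicator_def)
    then show ?thesis unfolding bounded_iff by blast
  qed
  have "exp (\<phi> x) - 1 = (exp t - 1) * indicator A x" for x
    by (simp add: \<phi>_def indicator_def)
  then have "(\<integral>x. exp (\<phi> x) - 1 \<partial>Q) = (exp t - 1) * measure Q A"
    using sp by simp
  moreover have "(\<integral>x. \<phi> x \<partial>N) = t * measure N A"
    unfolding \<phi>_def using sp by simp
  ultimately show ?thesis
    using order_trans[OF dual_entropy_upper[OF p b, of N Q] K] by simp
qed

lemma dual_entropy_uniformly_absolutely_continuous:
  assumes Q: "finite_measure Q" "sets Q = sets borel" and "\<epsilon> > 0"
  shows "\<exists>\<delta>>0. \<forall>N A. prob_space N \<longrightarrow> sets N = sets borel \<longrightarrow> dual_entropy Q N \<le> ereal K \<longrightarrow>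
    A \<in> sets borel \<longrightarrow> measure Q A < \<delta> \<longrightarrow> measure N A \<le> \<epsilon>"
proof -
  \<comment> \<open>\<open>t\<close> is chosen so that the entropy bound is at most half of
    \<open>t * \<epsilon>\<close>, and \<open>\<delta>\<close> below so that the exponential term is
    at most the other half; adding 1 keeps \<open>t\<close> positive when
    \<open>K = 0\<close>.\<close>
  define t where "t = 2 * (\<bar>K\<bar> + 1) / \<epsilon>"
  have t: "t > 0" "K \<le> t * \<epsilon> / 2" using \<open>\<epsilon> > 0\<close> by (auto simp: t_def)
  define \<delta> where "\<delta> = t * \<epsilon> / 2 / (exp t - 1)"
  have et: "exp t - 1 > 0" using t by simp
  have "\<delta> > 0" unfolding \<delta>_def using t et \<open>\<epsilon> > 0\<close> by simp
  moreover have "measure N A \<le> \<epsilon>"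
    if "prob_space N" "sets N = sets borel" "dual_entropy Q N \<le> ereal K" "A \<in> sets borel"
      "measure Q A < \<delta>" for N A
  proof -
    have "(exp t - 1) * measure Q A \<le> (exp t - 1) * \<delta>"
      using that(5) et by (intro mult_left_mono) auto
    also have "\<dots> = t * \<epsilon> / 2" unfolding \<delta>_def using et
      by (metis less_irrefl nonzero_mult_div_cancel_left times_divide_eq_right)
    finally have "t * measure N A \<le> t * \<epsilon>"
      using dual_entropy_measure_le[OF Q that(1-4), of t] t by linarith
    then show ?thesis using t by simp
  qed
  ultimately show ?thesis by blast
qed

text \<open>On a \<open>Q\<close>-null set the exponential term of
  \<open>dual_entropy_measure_le\<close> vanishes, so \<open>n * measure N A <= K\<close> for every
  \<open>n\<close>. The Radon-Nikodym density can be taken real-valued because \<open>N\<close> is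
  sigma-finite.\<close>

lemma dual_entropy_finite_imp_density:
  assumes Q: "finite_measure Q" "sets Q = sets borel"
    and N: "prob_space N" "sets N = sets borel"
    and fin: "dual_entropy Q N < \<infinity>"
  obtains g :: "_ \<Rightarrow> real" where "g \<in> borel_measurable borel" "\<And>x. 0 \<le> g x"
    "N = density Q (\<lambda>x. ennreal (g x))" "absolutely_continuous Q N"
proof -
  interpret Q: finite_measure Q by fact
  interpret N: prob_space N by fact
  obtain K where K: "dual_entropy Q N \<le> ereal K"
    using fin dual_entropy_nonneg[of Q N] by (cases "dual_entropy Q N") auto
  have ac: "absolutely_continuous Q N"
    unfolding absolutely_continuous_def
  proof
    fix A assume A: "A \<in> null_sets Q"
    then have Ab: "A \<in> sets borel" "measure Q A = 0" using Q(2) by (auto simp: measure_def)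
    have le: "real n * measure N A \<le> K" for n
      using dual_entropy_measure_le[OF Q N K Ab(1), of "real n"] Ab(2) by simp
    have "measure N A = 0"
    proof (rule ccontr)
      assume "measure N A \<noteq> 0"
      then have "measure N A > 0" by (simp add: order_less_le)
      then obtain n where "K < real n * measure N A" using reals_Archimedean3 by blast
      then show False using le[of n] by simp
    qed
    then show "A \<in> null_sets N" using Ab(1) N(2) by (auto simp: null_sets_def N.emeasure_eq_measure)
  qed
  have sQN: "sets N = sets Q" using Q N by simp
  define g where "g x = enn2real (RN_deriv Q N x)" for x
  have gm: "g \<in> borel_measurable borel"
  proof -
    have "g \<in> borel_measurable Q" unfolding g_def[abs_def] by measurable
    then show ?thesis using measurable_cong_sets[OF Q(2) refl] by blast
  qed
  have "AE x in Q. RN_deriv Q N x \<noteq> \<infinity>"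
    by (rule Q.RN_deriv_finite[OF N.sigma_finite_measure_axioms ac sQN])
  then have "AE x in Q. RN_deriv Q N x = ennreal (g x)"
    by eventually_elim (simp add: g_def ennreal_enn2real_if)
  then have "density Q (RN_deriv Q N) = density Q (\<lambda>x. ennreal (g x))"
    unfolding g_def by (intro density_cong) auto
  then have "N = density Q (\<lambda>x. ennreal (g x))" using Q.density_RN_deriv[OF ac sQN] by simp
  then show thesis using that gm ac by (simp add: g_def)
qed

text \<open>Integrating the Fenchel-Young inequality bounds the supremum from above. The formal
  maximiser \<open>ln g\<close> is in general unbounded and then not admissible, so the reverse
  bound is reached by truncation and Fatou's lemma; both sides may be infinite.\<close>

lemma dual_entropy_density:
  fixes g :: "'a::topological_space \<Rightarrow> real"
  assumes Q: "finite_measure Q" "sets Q = sets borel"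
    and g: "g \<in> borel_measurable borel" "\<And>x. 0 \<le> g x"
    and P: "prob_space (density Q (\<lambda>x. ennreal (g x)))"
  shows "dual_entropy Q (density Q (\<lambda>x. ennreal (g x))) =
    enn2ereal (\<integral>\<^sup>+x. ennreal (entropy_fun (g x)) \<partial>Q)" (is "dual_entropy Q ?N = enn2ereal ?I")
proof (rule antisym)
  interpret Q: finite_measure Q by fact
  interpret N: prob_space ?N by fact
  have mQ: "(borel_measurable Q :: ('a \<Rightarrow> real) set) = borel_measurable borel"
    by (rule measurable_cong_sets[OF Q(2) refl])
  have gQ[measurable]: "g \<in> borel_measurable Q" using g(1) mQ by simp
  have ig: "integrable Q g"
  proof (rule integrableI_nonneg)
    have "(\<integral>\<^sup>+x. ennreal (g x) \<partial>Q) = emeasure ?N (space Q)"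
      by (subst emeasure_density) (auto intro!: nn_integral_cong)
    also have "\<dots> < \<infinity>"
      using N.emeasure_finite[of "space Q"] by (simp add: less_top del: N.emeasure_finite)
    finally show "(\<integral>\<^sup>+x. ennreal (g x) \<partial>Q) < \<infinity>" .
  qed (use g gQ in auto)
  have igp: "integrable Q (\<lambda>x. g x * \<phi> x)" "(\<integral>x. \<phi> x \<partial>?N) = (\<integral>x. g x * \<phi> x \<partial>Q)"
    if p: "\<phi> \<in> borel_measurable borel" "bounded (range \<phi>)" for \<phi> :: "'a \<Rightarrow> real"
  proof -
    have pQ: "\<phi> \<in> borel_measurable Q" using p mQ by simp
    have "integrable ?N \<phi>" using p Q by (intro integrable_bounded_borel N.finite_measure_axioms) auto
    then show "integrable Q (\<lambda>x. g x * \<phi> x)"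
      using integrable_real_density[OF gQ _ pQ] g(2) by simp
    show "(\<integral>x. \<phi> x \<partial>?N) = (\<integral>x. g x * \<phi> x \<partial>Q)"
      using integral_real_density[OF gQ _ pQ] g(2) by simp
  qed
  have ie: "integrable Q (\<lambda>x. exp (\<phi> x) - 1)"
    if "\<phi> \<in> borel_measurable borel" "bounded (range \<phi>)" for \<phi> :: "'a \<Rightarrow> real"
    using that Q(2) by (intro integrable_bounded_borel Q bounded_range_exp) auto
  show "dual_entropy Q ?N \<le> enn2ereal ?I"
  proof (cases "?I = \<infinity>")
    case False
    have ih: "integrable Q (\<lambda>x. entropy_fun (g x))"
      using False g by (intro integrableI_nonneg) (auto simp: entropy_fun_nonneg less_top)
    then have I: "?I = ennreal (\<integral>x. entropy_fun (g x) \<partial>Q)"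
      using g by (intro nn_integral_eq_integral) (auto simp: entropy_fun_nonneg)
    have I0: "0 \<le> (\<integral>x. entropy_fun (g x) \<partial>Q)"
      using g by (intro integral_nonneg_AE) (auto simp: entropy_fun_nonneg)
    show ?thesis unfolding dual_entropy_def
    proof (rule SUP_least)
      fix \<phi> :: "'a \<Rightarrow> real" assume "\<phi> \<in> {\<phi>. \<phi> \<in> borel_measurable borel \<and> bounded (range \<phi>)}"
      then have p: "\<phi> \<in> borel_measurable borel" "bounded (range \<phi>)" by auto
      have "(\<integral>x. g x * \<phi> x \<partial>Q) \<le> (\<integral>x. entropy_fun (g x) + (exp (\<phi> x) - 1) \<partial>Q)"
        using igp[OF p] ie[OF p] ih entropy_fun_Young[OF g(2)]
        by (intro integral_mono Bochner_Integration.integrable_add) auto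
      also have "\<dots> = (\<integral>x. entropy_fun (g x) \<partial>Q) + (\<integral>x. exp (\<phi> x) - 1 \<partial>Q)"
        using ih ie[OF p] by (intro Bochner_Integration.integral_add) auto
      finally show "ereal ((\<integral>x. \<phi> x \<partial>?N) - (\<integral>x. exp (\<phi> x) - 1 \<partial>Q)) \<le> enn2ereal ?I"
        using I I0 igp(2)[OF p] by simp
    qed
  qed simp
  \<comment> \<open>Truncating \<open>g\<close> to \<open>[1 / (k + 1), k + 1]\<close> makes
    \<open>ln (h k x)\<close> an admissible test function. The index \<open>Suc k\<close> keeps the
    interval nonempty and away from 0.\<close>
  define h where "h k x = min (max (g x) (1 / real (Suc k))) (real (Suc k))" for k x
  have h_bounds: "1 / real (Suc k) \<le> h k x" "h k x \<le> real (Suc k)" for k x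
  proof -
    have "1 / real (Suc k) \<le> 1" by simp
    also have "1 \<le> real (Suc k)" by simp
    finally show "1 / real (Suc k) \<le> h k x" "h k x \<le> real (Suc k)" by (auto simp: h_def)
  qed
  have h_pos: "h k x > 0" for k x
    using less_le_trans[OF _ h_bounds(1)[of k x]] by simp
  have h_meas[measurable]: "h k \<in> borel_measurable borel" for k unfolding h_def[abs_def] using g(1) by measurable
  have [measurable]: "h k \<in> borel_measurable Q" for k using mQ by simp
  have lim: "(\<lambda>k. entropy_fun (h k x)) \<longlonglongrightarrow> entropy_fun (g x)" for x
  proof (cases "g x = 0")
    case True
    have inv: "(\<lambda>k. 1 / real (Suc k)) \<longlonglongrightarrow> 0" by (rule lim_1_over_n[THEN LIMSEQ_Suc])
    have "(\<lambda>k. ln (real (Suc k)) / real (Suc k)) \<longlonglongrightarrow> 0" by (rule lim_ln_over_n[THEN LIMSEQ_Suc])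
    then have "(\<lambda>k. - (ln (real (Suc k)) / real (Suc k)) - 1 / real (Suc k) + 1) \<longlonglongrightarrow> - 0 - 0 + 1"
      using inv by (intro tendsto_intros)
    moreover have "entropy_fun (h k x) = - (ln (real (Suc k)) / real (Suc k)) - 1 / real (Suc k) + 1" for k
    proof -
      have "1 / real (Suc k) \<le> real (Suc k)"
        using order_trans[of "1 / real (Suc k)" 1 "real (Suc k)"] by simp
      then have "h k x = 1 / real (Suc k)" using True by (simp add: h_def)
      then show ?thesis by (simp add: entropy_fun_def ln_div)
    qed
    ultimately show ?thesis using True by (simp add: entropy_fun_def)
  next
    case False
    then have gp: "g x > 0" using g(2)[of x] by simp
    obtain k0 where k0: "max (g x) (1 / g x) < real k0" using reals_Archimedean2 by blast
    have "h k x = g x" if "k \<ge> k0" for k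
    proof -
      have "g x \<le> real (Suc k)" "1 / g x \<le> real (Suc k)" using k0 that by auto
      then have "1 / real (Suc k) \<le> g x" using gp by (simp add: field_simps)
      then show ?thesis using \<open>g x \<le> real (Suc k)\<close> by (simp add: h_def)
    qed
    then have "eventually (\<lambda>k. entropy_fun (h k x) = entropy_fun (g x)) sequentially"
      unfolding eventually_sequentially by (intro exI[of _ k0]) simp
    then show ?thesis by (rule tendsto_eventually)
  qed
  have le: "enn2ereal (\<integral>\<^sup>+x. ennreal (entropy_fun (h k x)) \<partial>Q) \<le> dual_entropy Q ?N" for k
  proof -
    define \<phi> where "\<phi> x = ln (h k x)" for x
    have p: "\<phi> \<in> borel_measurable borel" unfolding \<phi>_def[abs_def] by measurable
    have b: "bounded (range \<phi>)"
    proof -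
      have "norm (\<phi> x) \<le> ln (real (Suc k))" for x
      proof -
        have "ln (1 / real (Suc k)) \<le> \<phi> x" "\<phi> x \<le> ln (real (Suc k))"
          unfolding \<phi>_def using h_bounds[of k x] h_pos[of k x] by (auto intro!: ln_mono simp del: of_nat_Suc)
        then show ?thesis by (simp add: ln_div abs_le_iff del: of_nat_Suc)
      qed
      then show ?thesis unfolding bounded_iff by blast
    qed
    have ep: "exp (\<phi> x) = h k x" for x unfolding \<phi>_def using h_pos by simp
    \<comment> \<open>The two sides differ by \<open>(g x - h k x) * ln (h k x)\<close>. Clipping
      from below happens at a level at most 1 and clipping from above at a level at least 1, so the
      two factors agree in sign.\<close>
    have "entropy_fun (h k x) \<le> g x * \<phi> x - (exp (\<phi> x) - 1)" for x
    proof -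
      have "0 \<le> (g x - h k x) * \<phi> x"
      proof -
        have trunc: "c = s \<or> s \<le> c \<and> c = a \<or> c \<le> s \<and> c = b"
          if "c = min (max s a) b" "a \<le> b" for a b c s :: real
          using that by (auto simp: min_def max_def)
        consider "h k x = g x" | "g x \<le> h k x" "h k x = 1 / real (Suc k)" | "h k x \<le> g x" "h k x = real (Suc k)"
          using trunc[OF h_def order_trans[OF h_bounds]] by blast
        then show ?thesis
        proof cases
          case 2
          then have "\<phi> x \<le> 0" by (simp add: \<phi>_def ln_div)
          then show ?thesis using 2 by (intro mult_nonpos_nonpos) auto
        next
          case 3
          then have "\<phi> x \<ge> 0" by (simp add: \<phi>_def)
          then show ?thesis using 3 by (intro mult_nonneg_nonneg) auto
        qed simp
      qed
      then show ?thesis unfolding ep by (simp add: entropy_fun_def \<phi>_def algebra_simps)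
    qed
    then have "(\<integral>\<^sup>+x. ennreal (entropy_fun (h k x)) \<partial>Q) \<le> (\<integral>\<^sup>+x. ennreal (g x * \<phi> x - (exp (\<phi> x) - 1)) \<partial>Q)"
      by (intro nn_integral_mono ennreal_leI) auto
    also have "\<dots> = ennreal (\<integral>x. g x * \<phi> x - (exp (\<phi> x) - 1) \<partial>Q)"
    proof (rule nn_integral_eq_integral)
      show "integrable Q (\<lambda>x. g x * \<phi> x - (exp (\<phi> x) - 1))"
        using igp(1)[OF p b] ie[OF p b] by (rule Bochner_Integration.integrable_diff)
      show "AE x in Q. 0 \<le> g x * \<phi> x - (exp (\<phi> x) - 1)"
        using \<open>\<And>x. entropy_fun (h k x) \<le> _ x\<close> entropy_fun_nonneg[OF less_imp_le[OF h_pos]]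
        by (intro AE_I2) (meson order_trans)
    qed
    also have "(\<integral>x. g x * \<phi> x - (exp (\<phi> x) - 1) \<partial>Q) = (\<integral>x. \<phi> x \<partial>?N) - (\<integral>x. exp (\<phi> x) - 1 \<partial>Q)"
      using igp[OF p b] ie[OF p b] by simp
    finally have "enn2ereal (\<integral>\<^sup>+x. ennreal (entropy_fun (h k x)) \<partial>Q)
        \<le> enn2ereal (ennreal ((\<integral>x. \<phi> x \<partial>?N) - (\<integral>x. exp (\<phi> x) - 1 \<partial>Q)))"
      by (simp add: less_eq_ennreal.rep_eq)
    also have "\<dots> \<le> max 0 (ereal ((\<integral>x. \<phi> x \<partial>?N) - (\<integral>x. exp (\<phi> x) - 1 \<partial>Q)))"
      by (simp add: ennreal.rep_eq)
    also have "\<dots> \<le> dual_entropy Q ?N"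
      using dual_entropy_upper[OF p b] dual_entropy_nonneg by simp
    finally show ?thesis .
  qed
  \<comment> \<open>Pointwise convergence of the truncated integrands and Fatou's lemma in
    \<open>k\<close> remove the truncation.\<close>
  have "?I = (\<integral>\<^sup>+x. liminf (\<lambda>k. ennreal (entropy_fun (h k x))) \<partial>Q)"
    by (intro nn_integral_cong lim_imp_Liminf[symmetric] tendsto_ennrealI lim) auto
  also have "\<dots> \<le> liminf (\<lambda>k. \<integral>\<^sup>+x. ennreal (entropy_fun (h k x)) \<partial>Q)"
    by (rule nn_integral_liminf) measurable
  finally have "enn2ereal ?I \<le> enn2ereal (liminf (\<lambda>k. \<integral>\<^sup>+x. ennreal (entropy_fun (h k x)) \<partial>Q))"
    by (simp add: less_eq_ennreal.rep_eq)
  also have "\<dots> = liminf (\<lambda>k. enn2ereal (\<integral>\<^sup>+x. ennreal (entropy_fun (h k x)) \<partial>Q))"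
    by (simp add: liminf_enn2ereal)
  also have "\<dots> \<le> dual_entropy Q ?N"
    by (rule order_trans[OF Liminf_le_Limsup Limsup_bounded]) (auto intro: always_eventually le)
  finally show "enn2ereal ?I \<le> dual_entropy Q ?N" .
qed

section \<open>Relative entropy of marginals and of product measures\<close>

lemma dual_entropy_snd_finite:
  fixes \<gamma> :: "('a::second_countable_topology \<times> 'b::second_countable_topology) measure"
  assumes Q: "finite_measure Q" "sets Q = sets borel" "measure Q UNIV > 0"
    and R: "finite_measure R" "sets R = sets borel"
    and \<gamma>: "prob_space \<gamma>" "sets \<gamma> = sets borel"
    and fin: "dual_entropy (Q \<Otimes>\<^sub>M R) \<gamma> < \<infinity>"
  shows "dual_entropy R (distr \<gamma> borel snd) < \<infinity>"
proof -
  interpret Q: finite_measure Q by fact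
  interpret R: finite_measure R by fact
  interpret \<gamma>: prob_space \<gamma> by fact
  interpret QR: pair_sigma_finite Q R ..
  define q where "q = measure Q UNIV"
  have q: "q > 0" using Q by (simp add: q_def)
  have sp: "space Q = UNIV" "space R = UNIV"
    using sets_eq_imp_space_eq[OF Q(2)] sets_eq_imp_space_eq[OF R(2)] by simp_all
  have snd_meas: "snd \<in> measurable \<gamma> borel"
    by (subst measurable_cong_sets[OF \<gamma>(2) refl])
      (intro borel_measurable_continuous_onI continuous_on_snd continuous_on_id)
  interpret J: prob_space "distr \<gamma> borel snd" by (rule \<gamma>.prob_space_distr[OF snd_meas])
  have fQR: "finite_measure (Q \<Otimes>\<^sub>M R)"
    by (rule finite_measure_pair_measure) (unfold_locales)
  obtain K where K: "dual_entropy (Q \<Otimes>\<^sub>M R) \<gamma> = ereal K"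
    using fin dual_entropy_nonneg[of "Q \<Otimes>\<^sub>M R" \<gamma>] by (cases "dual_entropy (Q \<Otimes>\<^sub>M R) \<gamma>") auto
  have "dual_entropy R (distr \<gamma> borel snd) \<le> ereal (K + ln q - q * measure R UNIV + measure R UNIV)"
    unfolding dual_entropy_def[of R]
  proof (rule SUP_least)
    fix \<psi> :: "'b \<Rightarrow> real" assume "\<psi> \<in> {\<phi>. \<phi> \<in> borel_measurable borel \<and> bounded (range \<phi>)}"
    then have p: "\<psi> \<in> borel_measurable borel" "bounded (range \<psi>)" by auto
    \<comment> \<open>Test functions of the second coordinate alone already control the entropy of
      the marginal. The shift by \<open>ln q\<close> compensates for the total mass \<open>q\<close>
      of \<open>Q\<close>, so that \<open>exp \<phi>\<close> has the same integral over the product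
      as \<open>exp \<psi>\<close> over \<open>R\<close>; the rest of the bound comes from the total
      masses.\<close>
    define \<phi> :: "'a \<times> 'b \<Rightarrow> real" where "\<phi> z = \<psi> (snd z) - ln q" for z
    have pm: "\<phi> \<in> borel_measurable borel" unfolding \<phi>_def[abs_def]
      using p(1) by (simp add: borel_prod[symmetric])
    have pb: "bounded (range \<phi>)"
    proof -
      obtain B where "\<And>x. norm (\<psi> x) \<le> B" using p(2) by (auto simp: bounded_iff)
      then have "norm (\<phi> z) \<le> B + \<bar>ln q\<bar>" for z
        unfolding \<phi>_def by (smt (verit) real_norm_def)
      then show ?thesis unfolding bounded_iff by blast
    qed
    have ie: "integrable R (\<lambda>y. exp (\<psi> y) - 1)"
      using p R(2) by (intro integrable_bounded_borel R bounded_range_exp) auto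
    have ie': "integrable R (\<lambda>y. exp (\<psi> y))"
      using Bochner_Integration.integrable_add[OF ie, of "\<lambda>_. 1"] by simp
    have "integrable (distr \<gamma> borel snd) \<psi>"
      by (intro integrable_bounded_borel J.finite_measure_axioms p) auto
    then have "integrable \<gamma> (\<lambda>z. \<psi> (snd z))" by (rule integrable_distr[OF snd_meas])
    then have "(\<integral>z. \<phi> z \<partial>\<gamma>) = (\<integral>y. \<psi> y \<partial>distr \<gamma> borel snd) - ln q"
      using integral_distr[OF snd_meas p(1)] unfolding \<phi>_def by (simp add: \<gamma>.prob_space)
    moreover have "(\<integral>z. exp (\<phi> z) - 1 \<partial>(Q \<Otimes>\<^sub>M R)) = (\<integral>y. exp (\<psi> y) \<partial>R) - q * measure R UNIV"
    proof -
      have i: "integrable (Q \<Otimes>\<^sub>M R) (\<lambda>z. exp (\<phi> z) - 1)"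
        using pm pb Q(2) R(2)
        by (intro integrable_bounded_borel fQR bounded_range_exp)
          (auto simp: borel_prod[symmetric] cong: sets_pair_measure_cong)
      have "(\<integral>z. exp (\<phi> z) - 1 \<partial>(Q \<Otimes>\<^sub>M R)) = (\<integral>x. \<integral>y. exp (\<phi> (x, y)) - 1 \<partial>R \<partial>Q)"
        using QR.integral_fst'[OF i] by simp
      also have "\<dots> = (\<integral>x. (1 / q) * (\<integral>y. exp (\<psi> y) \<partial>R) - measure R UNIV \<partial>Q)"
      proof (intro Bochner_Integration.integral_cong refl)
        fix x
        have "(\<integral>y. exp (\<phi> (x, y)) - 1 \<partial>R) = (\<integral>y. (1 / q) * exp (\<psi> y) - 1 \<partial>R)"
          unfolding \<phi>_def using q by (simp add: exp_diff)
        also have "\<dots> = (1 / q) * (\<integral>y. exp (\<psi> y) \<partial>R) - measure R UNIV"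
          using ie' sp by simp
        finally show "(\<integral>y. exp (\<phi> (x, y)) - 1 \<partial>R) = (1 / q) * (\<integral>y. exp (\<psi> y) \<partial>R) - measure R UNIV" .
      qed
      also have "\<dots> = q * ((1 / q) * (\<integral>y. exp (\<psi> y) \<partial>R) - measure R UNIV)"
        using sp by (simp add: q_def)
      also have "\<dots> = (\<integral>y. exp (\<psi> y) \<partial>R) - q * measure R UNIV"
        using q by (simp add: field_simps)
      finally show ?thesis .
    qed
    moreover have "(\<integral>y. exp (\<psi> y) - 1 \<partial>R) = (\<integral>y. exp (\<psi> y) \<partial>R) - measure R UNIV"
      using ie' sp by simp
    moreover have "(\<integral>z. \<phi> z \<partial>\<gamma>) - (\<integral>z. exp (\<phi> z) - 1 \<partial>(Q \<Otimes>\<^sub>M R)) \<le> K"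
      using dual_entropy_upper[OF pm pb, of \<gamma> "Q \<Otimes>\<^sub>M R"] K by simp
    ultimately show "ereal ((\<integral>y. \<psi> y \<partial>distr \<gamma> borel snd) - (\<integral>y. exp (\<psi> y) - 1 \<partial>R))
        \<le> ereal (K + ln q - q * measure R UNIV + measure R UNIV)" by simp
  qed
  then show ?thesis by (rule order_le_less_trans) simp
qed

text \<open>Makes the plan problem proper: the independent coupling of two measures of finite
  entropy is a competitor of finite entropy.\<close>

lemma dual_entropy_pair_finite:
  fixes \<mu> :: "'a::second_countable_topology measure" and \<nu> :: "'b::second_countable_topology measure"
  assumes Q: "finite_measure Q" "sets Q = sets borel"
    and R: "finite_measure R" "sets R = sets borel"
    and \<mu>: "prob_space \<mu>" "sets \<mu> = sets borel" "dual_entropy Q \<mu> < \<infinity>"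
    and \<nu>: "prob_space \<nu>" "sets \<nu> = sets borel" "dual_entropy R \<nu> < \<infinity>"
  shows "dual_entropy (Q \<Otimes>\<^sub>M R) (\<mu> \<Otimes>\<^sub>M \<nu>) < \<infinity>"
proof -
  interpret Q: finite_measure Q by fact
  interpret R: finite_measure R by fact
  interpret \<mu>: prob_space \<mu> by fact
  interpret \<nu>: prob_space \<nu> by fact
  interpret QR: pair_sigma_finite Q R ..
  interpret mn: pair_prob_space \<mu> \<nu> ..
  obtain f where f: "f \<in> borel_measurable borel" "\<And>x. 0 \<le> f x" "\<mu> = density Q (\<lambda>x. ennreal (f x))"
    using dual_entropy_finite_imp_density[OF Q \<mu>] by blast
  obtain g where g: "g \<in> borel_measurable borel" "\<And>x. 0 \<le> g x" "\<nu> = density R (\<lambda>x. ennreal (g x))"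
    using dual_entropy_finite_imp_density[OF R \<nu>] by blast
  have fQ[measurable]: "f \<in> borel_measurable Q" using f(1) measurable_cong_sets[OF Q(2) refl] by blast
  have gR[measurable]: "g \<in> borel_measurable R" using g(1) measurable_cong_sets[OF R(2) refl] by blast
  have sQR: "sets (Q \<Otimes>\<^sub>M R) = sets borel"
    using sets_pair_measure_cong[OF Q(2) R(2)] unfolding borel_prod .
  have d: "\<mu> \<Otimes>\<^sub>M \<nu> = density (Q \<Otimes>\<^sub>M R) (\<lambda>z. ennreal (f (fst z) * g (snd z)))"
  proof -
    have "\<mu> \<Otimes>\<^sub>M \<nu> = density (Q \<Otimes>\<^sub>M R) (\<lambda>(x, y). ennreal (f x) * ennreal (g y))"
      unfolding f(3) g(3)
      by (rule pair_measure_density) (use R.sigma_finite_measure_axioms \<nu>.sigma_finite_measure_axioms g(3) in auto)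
    then show ?thesis using f(2) g(2) by (simp add: split_beta' ennreal_mult)
  qed
  have "dual_entropy (Q \<Otimes>\<^sub>M R) (\<mu> \<Otimes>\<^sub>M \<nu>) =
      enn2ereal (\<integral>\<^sup>+z. ennreal (entropy_fun (f (fst z) * g (snd z))) \<partial>(Q \<Otimes>\<^sub>M R))"
    unfolding d
  proof (rule dual_entropy_density)
    show "finite_measure (Q \<Otimes>\<^sub>M R)" by (rule finite_measure_pair_measure) unfold_locales
    show "(\<lambda>z. f (fst z) * g (snd z)) \<in> borel_measurable borel"
      using f(1) g(1) by (simp add: borel_prod[symmetric])
    show "prob_space (density (Q \<Otimes>\<^sub>M R) (\<lambda>z. ennreal (f (fst z) * g (snd z))))"
      using mn.prob_space_axioms d by simp
  qed (use f(2) g(2) sQR in auto)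
  moreover have "(\<integral>\<^sup>+z. ennreal (entropy_fun (f (fst z) * g (snd z))) \<partial>(Q \<Otimes>\<^sub>M R)) < \<infinity>"
  proof -
    have Ef: "(\<integral>\<^sup>+x. ennreal (entropy_fun (f x)) \<partial>Q) < \<infinity>"
      using dual_entropy_density[OF Q f(1,2)] \<mu>(1,3) f(3) by (simp add: less_top)
    have Eg: "(\<integral>\<^sup>+x. ennreal (entropy_fun (g x)) \<partial>R) < \<infinity>"
      using dual_entropy_density[OF R g(1,2)] \<nu>(1,3) g(3) by (simp add: less_top)
    have If: "(\<integral>\<^sup>+x. ennreal (f x) \<partial>Q) = 1"
      using \<mu>.emeasure_space_1 by (simp add: f(3) emeasure_density cong: nn_integral_cong)
    have Ig: "(\<integral>\<^sup>+x. ennreal (g x) \<partial>R) = 1"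
      using \<nu>.emeasure_space_1 by (simp add: g(3) emeasure_density cong: nn_integral_cong)
    \<comment> \<open>\<open>entropy_fun_mult\<close> dominates the integrand by products of a
      function of each variable, and Tonelli's theorem leaves integrals over \<open>Q\<close> or
      \<open>R\<close> alone. The summand 1 contributes the product of the total masses, which is
      finite.\<close>
    have "(\<integral>\<^sup>+z. ennreal (entropy_fun (f (fst z) * g (snd z))) \<partial>(Q \<Otimes>\<^sub>M R)) \<le>
      (\<integral>\<^sup>+z. ennreal (entropy_fun (f (fst z))) * ennreal (g (snd z))
        + ennreal (f (fst z)) * ennreal (entropy_fun (g (snd z)))
        + ennreal (f (fst z)) * ennreal (g (snd z)) + 1 \<partial>(Q \<Otimes>\<^sub>M R))"
    proof (rule nn_integral_mono)
      fix z
      have "ennreal (entropy_fun (f (fst z) * g (snd z))) \<le>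
        ennreal (entropy_fun (f (fst z)) * g (snd z) + f (fst z) * entropy_fun (g (snd z)) + f (fst z) * g (snd z) + 1)"
        using entropy_fun_mult[OF f(2) g(2)] by (intro ennreal_leI) (simp add: mult.commute)
      also have "\<dots> = ennreal (entropy_fun (f (fst z))) * ennreal (g (snd z))
        + ennreal (f (fst z)) * ennreal (entropy_fun (g (snd z)))
        + ennreal (f (fst z)) * ennreal (g (snd z)) + 1"
        using f(2) g(2) by (simp add: ennreal_mult entropy_fun_nonneg)
      finally show "ennreal (entropy_fun (f (fst z) * g (snd z))) \<le> ennreal (entropy_fun (f (fst z))) * ennreal (g (snd z))
        + ennreal (f (fst z)) * ennreal (entropy_fun (g (snd z)))
        + ennreal (f (fst z)) * ennreal (g (snd z)) + 1" .
    qed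
    also have "\<dots> = (\<integral>\<^sup>+x. \<integral>\<^sup>+y. ennreal (entropy_fun (f x)) * ennreal (g y)
        + ennreal (f x) * ennreal (entropy_fun (g y))
        + ennreal (f x) * ennreal (g y) + 1 \<partial>R \<partial>Q)"
      by (subst R.nn_integral_fst[symmetric]) auto
    also have "\<dots> = (\<integral>\<^sup>+x. ennreal (entropy_fun (f x)) 
        + ennreal (f x) * (\<integral>\<^sup>+y. ennreal (entropy_fun (g y)) \<partial>R)
        + ennreal (f x) + emeasure R (space R) \<partial>Q)"
      by (simp add: nn_integral_add nn_integral_cmult Ig)
    also have "\<dots> = (\<integral>\<^sup>+x. ennreal (entropy_fun (f x)) \<partial>Q)
        + (\<integral>\<^sup>+y. ennreal (entropy_fun (g y)) \<partial>R) + 1 + emeasure R (space R) * emeasure Q (space Q)"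
      by (simp add: nn_integral_add nn_integral_multc If)
    also have "\<dots> < \<infinity>"
    proof -
      have "emeasure Q (space Q) < top" "emeasure R (space R) < top"
        using Q.emeasure_finite[of "space Q"] R.emeasure_finite[of "space R"] less_top by blast+
      then show ?thesis using Ef Eg by (simp add: ennreal_mult_less_top)
    qed
    finally show ?thesis .
  qed
  ultimately show ?thesis by (simp add: less_top)
qed

section \<open>Boltzmann entropy and Gaussian reference measures\<close>

text \<open>Left unnormalised: the logarithm of its density is then exactly minus
  \<open>\<delta>\<close> times the squared norm, and a product of two such measures is again of
  this form without constants.\<close>

definition gauss_ref :: "real \<Rightarrow> 'a::euclidean_space measure" where
  "gauss_ref \<delta> = density lborel (\<lambda>x. ennreal (exp (- \<delta> * (norm x)\<^sup>2)))"

lemma sets_gauss_ref [simp]: "sets (gauss_ref \<delta>) = sets borel"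
  by (simp add: gauss_ref_def)

lemma space_gauss_ref [simp]: "space (gauss_ref \<delta>) = UNIV"
  by (simp add: gauss_ref_def)

lemma finite_measure_gauss_ref:
  assumes "\<delta> > 0" shows "finite_measure (gauss_ref \<delta> :: 'a::euclidean_space measure)"
proof
  \<comment> \<open>The standard deviation matching the exponent \<open>\<delta>\<close>, so that
    the one-dimensional integral is that of a normal density. The squared norm is a sum over
    coordinates, which factors the full integral.\<close>
  define s where "s = sqrt (1 / (2 * \<delta>))"
  have s: "s > 0" "2 * s\<^sup>2 = 1 / \<delta>" using assms by (auto simp: s_def)
  have one: "(\<integral>\<^sup>+t. ennreal (exp (- \<delta> * t\<^sup>2)) \<partial>lborel) < \<infinity>"
  proof -
    have "exp (- \<delta> * t\<^sup>2) = sqrt (2 * pi * s\<^sup>2) * normal_density 0 s t" for t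
    proof -
      have "- (t\<^sup>2 / (2 * s\<^sup>2)) = - \<delta> * t\<^sup>2" using s by (simp add: s(2))
      moreover have "sqrt (2 * pi * s\<^sup>2) \<noteq> 0" using s by simp
      ultimately show ?thesis by (simp add: normal_density_def)
    qed
    then have "integrable lborel (\<lambda>t. exp (- \<delta> * t\<^sup>2))"
      using s integrable_normal_density by simp
    then show ?thesis by (simp add: nn_integral_eq_integral less_top)
  qed
  have "emeasure (gauss_ref \<delta> :: 'a measure) (space (gauss_ref \<delta>)) = (\<integral>\<^sup>+x. ennreal (exp (- \<delta> * (norm (x::'a))\<^sup>2)) \<partial>lborel)"
    by (simp add: gauss_ref_def emeasure_density)
  also have "\<dots> = (\<integral>\<^sup>+x. (\<Prod>b\<in>Basis. ennreal (exp (- \<delta> * ((x::'a) \<bullet> b)\<^sup>2))) \<partial>lborel)"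
  proof (rule nn_integral_cong)
    fix x :: 'a
    have "(norm x)\<^sup>2 = (\<Sum>b\<in>Basis. (x \<bullet> b)\<^sup>2)"
      by (subst power2_norm_eq_inner, subst euclidean_inner) (simp add: power2_eq_square)
    then have "exp (- \<delta> * (norm x)\<^sup>2) = (\<Prod>b\<in>Basis. exp (- \<delta> * (x \<bullet> b)\<^sup>2))"
      by (simp add: sum_distrib_left exp_sum sum_negf[symmetric])
    then show "ennreal (exp (- \<delta> * (norm x)\<^sup>2)) = (\<Prod>b\<in>Basis. ennreal (exp (- \<delta> * (x \<bullet> b)\<^sup>2)))"
      by (simp add: prod_ennreal)
  qed
  also have "\<dots> = (\<Prod>b\<in>(Basis :: 'a set). (\<integral>\<^sup>+t. ennreal (exp (- \<delta> * t\<^sup>2)) \<partial>lborel))"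
    by (rule nn_integral_lborel_prod) auto
  also have "\<dots> \<noteq> \<infinity>"
  proof -
    obtain c where "(\<integral>\<^sup>+t. ennreal (exp (- \<delta> * t\<^sup>2)) \<partial>lborel) = ennreal c" "0 \<le> c"
      using one by (cases "\<integral>\<^sup>+t. ennreal (exp (- \<delta> * t\<^sup>2)) \<partial>lborel") auto
    then show ?thesis by (simp add: ennreal_power)
  qed
  finally show "emeasure (gauss_ref \<delta> :: 'a measure) (space (gauss_ref \<delta>)) \<noteq> \<infinity>" .
qed

text \<open>The total mass occurs inside a logarithm when the entropy of a plan is projected to its
  second marginal.\<close>

lemma measure_gauss_ref_pos:
  assumes "\<delta> > 0" shows "measure (gauss_ref \<delta> :: 'a::euclidean_space measure) UNIV > 0"
proof -
  interpret finite_measure "gauss_ref \<delta> :: 'a measure" by (rule finite_measure_gauss_ref[OF assms])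
  have "emeasure (gauss_ref \<delta> :: 'a measure) UNIV \<noteq> 0"
  proof
    assume "emeasure (gauss_ref \<delta> :: 'a measure) UNIV = 0"
    then have "AE x in (lborel :: 'a measure). ennreal (exp (- \<delta> * (norm x)\<^sup>2)) = 0"
      by (simp add: gauss_ref_def emeasure_density nn_integral_0_iff_AE)
    then have "AE x in (lborel :: 'a measure). False" by simp
    then have "emeasure (lborel :: 'a measure) UNIV = 0" by (subst (asm) AE_iff_measurable[OF _ refl]) auto
    then show False by (simp add: emeasure_lborel_UNIV)
  qed
  then show ?thesis by (simp add: emeasure_eq_measure less_le)
qed

text \<open>The squared norm of a pair is the sum of the squared norms, so one
  \<open>\<delta>\<close> serves plans and marginals alike; this is how finiteness of the entropy
  travels between them.\<close>

lemma gauss_ref_pair: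
  assumes "\<delta> > 0"
  shows "gauss_ref \<delta> \<Otimes>\<^sub>M gauss_ref \<delta> = (gauss_ref \<delta> :: ('a::euclidean_space \<times> 'b::euclidean_space) measure)"
proof -
  have "gauss_ref \<delta> \<Otimes>\<^sub>M gauss_ref \<delta> = density ((lborel :: 'a measure) \<Otimes>\<^sub>M (lborel :: 'b measure))
      (\<lambda>(x, y). ennreal (exp (- \<delta> * (norm x)\<^sup>2)) * ennreal (exp (- \<delta> * (norm y)\<^sup>2)))"
    unfolding gauss_ref_def
    by (rule pair_measure_density)
      (use finite_measure.sigma_finite_measure[OF finite_measure_gauss_ref[OF assms]] in
        \<open>auto simp: gauss_ref_def sigma_finite_lborel\<close>)
  moreover have "(\<lambda>(x::'a, y::'b). ennreal (exp (- \<delta> * (norm x)\<^sup>2)) * ennreal (exp (- \<delta> * (norm y)\<^sup>2)))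
      = (\<lambda>z. ennreal (exp (- \<delta> * (norm z)\<^sup>2)))"
    by (auto simp: fun_eq_iff norm_prod_def ennreal_mult[symmetric] exp_add[symmetric] algebra_simps)
  ultimately show ?thesis unfolding gauss_ref_def lborel_prod by simp
qed

text \<open>The balance is stated additively because \<open>P\<close> and \<open>U\<close> may both
  be infinite; only the finite quantities \<open>N\<close> and \<open>a\<close> change sides, and
  they do so in \<open>ereal\<close>.\<close>

lemma enn2ereal_diff_eq:
  assumes eq: "P + ennreal a = U + 1 + N" and "0 \<le> a" and fin: "N \<noteq> \<infinity>"
  shows "enn2ereal P - enn2ereal N = enn2ereal U + ereal (1 - a)"
proof -
  obtain n where n: "N = ennreal n" "0 \<le> n" using fin by (cases N) auto
  show ?thesis
  proof (cases "U = \<infinity>")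
    case True
    then have "P = \<infinity>" using eq by (cases P) (auto simp: ennreal_plus[symmetric] simp del: ennreal_plus)
    then show ?thesis using True n by simp
  next
    case False
    then obtain u where u: "U = ennreal u" "0 \<le> u" by (cases U) auto
    then have sum: "P + ennreal a = ennreal (u + 1 + n)" using eq n by simp
    then obtain p where p: "P = ennreal p" "0 \<le> p" by (cases P) auto
    then have "ennreal (p + a) = ennreal (u + 1 + n)" using sum \<open>0 \<le> a\<close> by simp
    then have "p + a = u + 1 + n" using p u n \<open>0 \<le> a\<close> by (subst (asm) ennreal_inj) auto
    then show ?thesis using p u n by simp
  qed
qed

lemma P2_D:
  assumes "\<rho> \<in> P2"
  shows "prob_space \<rho>" "sets \<rho> = sets borel" "integrable \<rho> (\<lambda>x. (norm x)\<^sup>2)" "space \<rho> = UNIV"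
  using assms sets_eq_imp_space_eq[of \<rho> borel] by (auto simp: P2_def)

text \<open>Relative to a Gaussian reference measure the entropy becomes nonnegative, at the price of a
  second moment with a small coefficient \<open>\<delta>\<close>.\<close>

lemma boltzmann_entropy_eq_dual_entropy:
  fixes \<gamma> :: "'a::euclidean_space measure"
  assumes d: "\<delta> > 0" and \<gamma>: "\<gamma> \<in> P2"
  shows "boltzmann_entropy \<gamma> = dual_entropy (gauss_ref \<delta>) \<gamma>
    + ereal (1 - (measure (gauss_ref \<delta> :: 'a measure) UNIV + \<delta> * (\<integral>x. (norm x)\<^sup>2 \<partial>\<gamma>)))"
proof (cases "absolutely_continuous lborel \<gamma>")
  case False
  have "dual_entropy (gauss_ref \<delta>) \<gamma> = \<infinity>"
  proof (rule ccontr)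
    assume "dual_entropy (gauss_ref \<delta>) \<gamma> \<noteq> \<infinity>"
    then have "dual_entropy (gauss_ref \<delta>) \<gamma> < \<infinity>" by simp
    then have ac: "absolutely_continuous (gauss_ref \<delta>) \<gamma>"
      using dual_entropy_finite_imp_density[OF finite_measure_gauss_ref[OF d] sets_gauss_ref P2_D(1,2)[OF \<gamma>]]
      by blast
    \<comment> \<open>Finite relative entropy would give absolute continuity with respect to the
      Gaussian and hence to Lebesgue measure, so in this case both sides of the identity are
      infinite.\<close>
    have "absolutely_continuous lborel (gauss_ref \<delta> :: 'a measure)"
      unfolding gauss_ref_def by (rule absolutely_continuousI_density) simp
    then show False using ac False by (auto simp: absolutely_continuous_def)
  qed
  then show ?thesis using False by (simp add: boltzmann_entropy_def)
next
  case True
  interpret \<gamma>: prob_space \<gamma> by (rule P2_D(1)[OF \<gamma>])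
  define f where "f x = enn2real (RN_deriv lborel \<gamma> x)" for x
  define q where "q x = exp (- \<delta> * (norm x)\<^sup>2)" for x :: 'a
  define g where "g x = f x / q x" for x
  define m where "m = (\<integral>x. (norm x)\<^sup>2 \<partial>\<gamma>)"
  have f0: "0 \<le> f x" for x by (simp add: f_def)
  have q0: "0 < q x" for x by (simp add: q_def)
  have g0: "0 \<le> g x" for x using f0[of x] q0[of x] by (simp add: g_def)
  have [measurable]: "f \<in> borel_measurable borel"
    using borel_measurable_RN_deriv[of lborel \<gamma>] unfolding f_def[abs_def] by simp
  have [measurable]: "q \<in> borel_measurable borel" unfolding q_def[abs_def] by measurable
  have [measurable]: "g \<in> borel_measurable borel" unfolding g_def[abs_def] by measurable
  have m0: "0 \<le> m" unfolding m_def by (intro integral_nonneg_AE) auto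
  have sl: "sets \<gamma> = sets lborel" using P2_D(2)[OF \<gamma>] by simp
  have "AE x in lborel. RN_deriv lborel \<gamma> x \<noteq> \<infinity>"
    by (rule sigma_finite_measure.RN_deriv_finite[OF sigma_finite_lborel \<gamma>.sigma_finite_measure_axioms True sl])
  then have "AE x in lborel. RN_deriv lborel \<gamma> x = ennreal (f x)"
    by eventually_elim (simp add: f_def ennreal_enn2real_if)
  then have "density lborel (RN_deriv lborel \<gamma>) = density lborel (\<lambda>x. ennreal (f x))"
    by (intro density_cong) auto
  then have \<gamma>f: "\<gamma> = density lborel (\<lambda>x. ennreal (f x))"
    using sigma_finite_measure.density_RN_deriv[OF sigma_finite_lborel True sl] by simp
  have gq: "ennreal (q x) * ennreal (g x) = ennreal (f x)" for x
    using q0[of x] g0[of x] by (simp add: ennreal_mult[symmetric] g_def)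
  have \<gamma>g: "\<gamma> = density (gauss_ref \<delta>) (\<lambda>x. ennreal (g x))"
    unfolding gauss_ref_def q_def[symmetric] using \<gamma>f
    by (subst density_density_eq) (simp_all add: gq)
  have U: "dual_entropy (gauss_ref \<delta>) \<gamma> = enn2ereal (\<integral>\<^sup>+x. ennreal (q x * entropy_fun (g x)) \<partial>lborel)"
  proof -
    have "dual_entropy (gauss_ref \<delta>) \<gamma> = enn2ereal (\<integral>\<^sup>+x. ennreal (entropy_fun (g x)) \<partial>gauss_ref \<delta>)"
      unfolding \<gamma>g using \<gamma>.prob_space_axioms \<gamma>g g0
      by (intro dual_entropy_density finite_measure_gauss_ref[OF d]) auto
    also have "(\<integral>\<^sup>+x. ennreal (entropy_fun (g x)) \<partial>gauss_ref \<delta>) = (\<integral>\<^sup>+x. ennreal (q x) * ennreal (entropy_fun (g x)) \<partial>lborel)"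
      unfolding gauss_ref_def by (subst nn_integral_density) (auto simp: q_def)
    also have "\<dots> = (\<integral>\<^sup>+x. ennreal (q x * entropy_fun (g x)) \<partial>lborel)"
      using q0 g0 by (intro nn_integral_cong) (simp add: ennreal_mult entropy_fun_nonneg less_imp_le)
    finally show ?thesis .
  qed
  \<comment> \<open>Since \<open>g = f / q\<close>, one has
    \<open>ln (g x) = ln (f x) + \<delta> * (norm x)\<^sup>2\<close> where \<open>f\<close> is
    positive. Where \<open>f\<close> vanishes, \<open>entropy_fun 0 = 1\<close> supplies exactly the
    term \<open>q x\<close>.\<close>
  have qh: "q x * entropy_fun (g x) = f x * ln (f x) + \<delta> * (norm x)\<^sup>2 * f x - f x + q x" for x
  proof (cases "f x = 0")
    case False
    then have "ln (g x) = ln (f x) + \<delta> * (norm x)\<^sup>2"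
      using f0[of x] q0[of x] by (simp add: g_def ln_div) (simp add: q_def)
    then show ?thesis using q0[of x] by (simp add: entropy_fun_def g_def field_simps)
  qed (simp add: g_def entropy_fun_def)
  have If: "(\<integral>\<^sup>+x. ennreal (f x) \<partial>lborel) = 1"
    using \<gamma>.emeasure_space_1 by (subst (asm) (1) \<gamma>f) (simp add: emeasure_density P2_D(4)[OF \<gamma>])
  have Iq: "(\<integral>\<^sup>+x. ennreal (q x) \<partial>lborel) = ennreal (measure (gauss_ref \<delta> :: 'a measure) UNIV)"
  proof -
    have "(\<integral>\<^sup>+x. ennreal (q x) \<partial>lborel) = emeasure (gauss_ref \<delta> :: 'a measure) UNIV"
      by (simp add: gauss_ref_def emeasure_density q_def)
    then show ?thesis by (simp add: finite_measure.emeasure_eq_measure[OF finite_measure_gauss_ref[OF d]])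
  qed
  have Im: "(\<integral>\<^sup>+x. ennreal (\<delta> * (norm x)\<^sup>2 * f x) \<partial>lborel) = ennreal (\<delta> * m)"
  proof -
    have "(\<integral>\<^sup>+x. ennreal (\<delta> * (norm x)\<^sup>2 * f x) \<partial>lborel) = (\<integral>\<^sup>+x. ennreal (f x) * ennreal (\<delta> * (norm x)\<^sup>2) \<partial>lborel)"
      using f0 d by (intro nn_integral_cong) (simp add: ennreal_mult[symmetric] mult.commute)
    also have "\<dots> = (\<integral>\<^sup>+x. ennreal (\<delta> * (norm x)\<^sup>2) \<partial>\<gamma>)"
      by (subst \<gamma>f, subst nn_integral_density) auto
    also have "\<dots> = ennreal (\<integral>x. \<delta> * (norm x)\<^sup>2 \<partial>\<gamma>)"
      using P2_D(3)[OF \<gamma>] d by (intro nn_integral_eq_integral) auto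
    finally show ?thesis by (simp add: m_def)
  qed
  define P where "P = (\<integral>\<^sup>+x. ennreal (f x * ln (f x)) \<partial>lborel)"
  define N where "N = (\<integral>\<^sup>+x. ennreal (- (f x * ln (f x))) \<partial>lborel)"
  define Z where "Z = measure (gauss_ref \<delta> :: 'a measure) UNIV"
  \<comment> \<open>Nonnegativity of \<open>entropy_fun\<close> bounds the negative part of the
    entropy integrand by the Gaussian plus the weighted second-moment density; this is why the
    Boltzmann entropy is well defined on \<open>P2\<close>.\<close>
  have "N \<le> (\<integral>\<^sup>+x. ennreal (q x) + ennreal (\<delta> * (norm x)\<^sup>2 * f x) \<partial>lborel)"
    unfolding N_def
  proof (rule nn_integral_mono)
    fix x
    have "0 \<le> q x * entropy_fun (g x)" using q0[of x] g0 by (simp add: entropy_fun_nonneg less_imp_le)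
    then have "- (f x * ln (f x)) \<le> q x + \<delta> * (norm x)\<^sup>2 * f x" using qh[of x] f0[of x] by linarith
    then have "ennreal (- (f x * ln (f x))) \<le> ennreal (q x + \<delta> * (norm x)\<^sup>2 * f x)" by (rule ennreal_leI)
    then show "ennreal (- (f x * ln (f x))) \<le> ennreal (q x) + ennreal (\<delta> * (norm x)\<^sup>2 * f x)"
      using q0[of x] f0[of x] d by (simp add: less_imp_le)
  qed
  also have "\<dots> = ennreal Z + ennreal (\<delta> * m)"
    by (subst nn_integral_add) (auto simp: Iq Im Z_def)
  finally have N: "N \<noteq> \<infinity>" by (auto simp: top_unique)
  \<comment> \<open>The pointwise identity \<open>qh\<close> is rearranged so that every term is
    nonnegative, the sign of \<open>f x * ln (f x)\<close> deciding which of its two parts vanishes.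
    In this form it can be integrated even when the entropy is infinite.\<close>
  have "P + ennreal (Z + \<delta> * m) = (\<integral>\<^sup>+x. ennreal (f x * ln (f x)) + (ennreal (q x) + ennreal (\<delta> * (norm x)\<^sup>2 * f x)) \<partial>lborel)"
    unfolding P_def using m0 d by (simp add: nn_integral_add Iq Im Z_def)
  also have "\<dots> = (\<integral>\<^sup>+x. ennreal (q x * entropy_fun (g x)) + ennreal (f x) + ennreal (- (f x * ln (f x))) \<partial>lborel)"
  proof (rule nn_integral_cong)
    fix x
    have nn: "0 \<le> q x * entropy_fun (g x)" using q0[of x] g0 by (simp add: entropy_fun_nonneg less_imp_le)
    have nn': "0 \<le> \<delta> * (norm x)\<^sup>2 * f x" using d f0[of x] by simp
    show "ennreal (f x * ln (f x)) + (ennreal (q x) + ennreal (\<delta> * (norm x)\<^sup>2 * f x))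
        = ennreal (q x * entropy_fun (g x)) + ennreal (f x) + ennreal (- (f x * ln (f x)))"
    proof (cases "0 \<le> f x * ln (f x)")
      case True
      then have e: "ennreal (- (f x * ln (f x))) = 0" by (intro ennreal_neg) simp
      have "ennreal (f x * ln (f x)) + (ennreal (q x) + ennreal (\<delta> * (norm x)\<^sup>2 * f x))
          = ennreal (f x * ln (f x) + (q x + \<delta> * (norm x)\<^sup>2 * f x))"
        using True nn' q0[of x] by (simp del: ennreal_plus add: ennreal_plus[symmetric] less_imp_le)
      also have "f x * ln (f x) + (q x + \<delta> * (norm x)\<^sup>2 * f x) = q x * entropy_fun (g x) + f x" using qh[of x] by simp
      also have "ennreal \<dots> = ennreal (q x * entropy_fun (g x)) + ennreal (f x)"
        using nn f0[of x] by (rule ennreal_plus)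
      finally show ?thesis unfolding e by simp
    next
      case False
      then have e: "ennreal (f x * ln (f x)) = 0" by (intro ennreal_neg) simp
      have "ennreal (q x) + ennreal (\<delta> * (norm x)\<^sup>2 * f x) = ennreal (q x + \<delta> * (norm x)\<^sup>2 * f x)"
        using nn' q0[of x] by (simp del: ennreal_plus add: ennreal_plus[symmetric] less_imp_le)
      also have "q x + \<delta> * (norm x)\<^sup>2 * f x = (q x * entropy_fun (g x) + f x) + (- (f x * ln (f x)))" using qh[of x] by simp
      also have "ennreal \<dots> = ennreal (q x * entropy_fun (g x) + f x) + ennreal (- (f x * ln (f x)))"
        using nn f0[of x] False by (intro ennreal_plus) auto
      also have "ennreal (q x * entropy_fun (g x) + f x) = ennreal (q x * entropy_fun (g x)) + ennreal (f x)"
        using nn f0[of x] by (rule ennreal_plus)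
      finally show ?thesis unfolding e by simp
    qed
  qed
  also have "\<dots> = (\<integral>\<^sup>+x. ennreal (q x * entropy_fun (g x)) \<partial>lborel) + 1 + N"
    unfolding N_def by (simp add: nn_integral_add If)
  finally have "enn2ereal P - enn2ereal N = enn2ereal (\<integral>\<^sup>+x. ennreal (q x * entropy_fun (g x)) \<partial>lborel) + ereal (1 - (Z + \<delta> * m))"
    using m0 d N by (intro enn2ereal_diff_eq) (auto simp: Z_def)
  moreover have "boltzmann_entropy \<gamma> = enn2ereal P - enn2ereal N"
    using True by (simp add: boltzmann_entropy_def P_def N_def f_def Let_def)
  ultimately show ?thesis unfolding U by (simp add: Z_def m_def)
qed

lemma finite_boltzmann_entropy_iff:
  assumes "\<delta> > 0" "\<gamma> \<in> P2"
  shows "\<bar>boltzmann_entropy \<gamma>\<bar> \<noteq> \<infinity> \<longleftrightarrow> dual_entropy (gauss_ref \<delta>) \<gamma> < \<infinity>"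
  unfolding boltzmann_entropy_eq_dual_entropy[OF assms]
  using dual_entropy_nonneg[of "gauss_ref \<delta>" \<gamma>]
  by (cases "dual_entropy (gauss_ref \<delta>) \<gamma>") auto

section \<open>Plans with finite second moments\<close>

lemma P2_I:
  "prob_space \<rho> \<Longrightarrow> sets \<rho> = sets borel \<Longrightarrow> integrable \<rho> (\<lambda>x. (norm x)\<^sup>2) \<Longrightarrow> \<rho> \<in> P2"
  by (simp add: P2_def)

lemma borel_measurable_continuous_sets:
  "sets M = sets borel \<Longrightarrow> continuous_on UNIV f \<Longrightarrow> f \<in> borel_measurable M"
  using borel_measurable_continuous_onI measurable_cong_sets by blast

lemma integrable_of_bound:
  fixes f g :: "'a::topological_space \<Rightarrow> real"
  assumes "sets M = sets borel" "continuous_on UNIV f" "integrable M g" "\<And>x. \<bar>f x\<bar> \<le> g x"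
  shows "integrable M f"
  by (rule Bochner_Integration.integrable_bound[OF assms(3) borel_measurable_continuous_sets[OF assms(1,2)]])
    (use assms(4) in \<open>auto intro!: AE_I2 order_trans[OF assms(4) abs_ge_self]\<close>)

lemma P2_distr:
  fixes f :: "'a::euclidean_space \<Rightarrow> 'b::euclidean_space"
  assumes \<gamma>: "\<gamma> \<in> P2" and f: "continuous_on UNIV f" and bound: "\<And>x. (norm (f x))\<^sup>2 \<le> C * (norm x)\<^sup>2"
  shows "distr \<gamma> borel f \<in> P2"
proof (rule P2_I)
  have fm: "f \<in> measurable \<gamma> borel" by (rule borel_measurable_continuous_sets[OF P2_D(2)[OF \<gamma>] f])
  show "prob_space (distr \<gamma> borel f)" by (rule prob_space.prob_space_distr[OF P2_D(1)[OF \<gamma>] fm])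
  have "integrable \<gamma> (\<lambda>x. (norm (f x))\<^sup>2)"
    by (rule integrable_of_bound[where g="\<lambda>x. C * (norm x)\<^sup>2"])
      (use P2_D[OF \<gamma>] f bound in \<open>auto intro!: continuous_intros\<close>)
  then show "integrable (distr \<gamma> borel f) (\<lambda>x. (norm x)\<^sup>2)"
    by (subst integrable_distr_eq[OF fm]) auto
qed simp

lemma return_0_P2: "return borel (0 :: 'a::euclidean_space) \<in> P2"
proof (rule P2_I)
  show "prob_space (return borel (0 :: 'a))" by (rule prob_space_return) simp
  show "integrable (return borel (0 :: 'a)) (\<lambda>x. (norm x)\<^sup>2)"
    by (intro integrableI_nonneg) (auto simp: nn_integral_return)
qed simp

lemma norm_Pair_power2: "(norm (x, y))\<^sup>2 = (norm x)\<^sup>2 + (norm y)\<^sup>2"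
  by (simp add: norm_prod_def)

lemma norm_diff_power2_le: "(norm (x - y :: 'a::real_inner))\<^sup>2 \<le> 2 * (norm x)\<^sup>2 + 2 * (norm y)\<^sup>2"
proof -
  have "0 \<le> (norm (x + y))\<^sup>2" by simp
  then show ?thesis by (simp add: power2_norm_eq_inner inner_diff inner_add inner_commute algebra_simps)
qed

text \<open>Expand the squared norm of \<open>x\<close> plus or minus \<open>\<theta>\<close> times
  \<open>y\<close>, divided by \<open>\<theta>\<close>. In the applications \<open>x\<close> has a
  fixed law, so its large coefficient is harmless, while the coefficient of \<open>y\<close> stays
  close to 1.\<close>

lemma norm_diff_power2_le_eps:
  fixes x y :: "'a::real_inner" assumes "\<theta> > 0"
  shows "(norm (x - y))\<^sup>2 \<le> (1 + 1 / \<theta>) * (norm x)\<^sup>2 + (1 + \<theta>) * (norm y)\<^sup>2"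
    and "(1 - \<theta>) * (norm y)\<^sup>2 - (1 / \<theta> - 1) * (norm x)\<^sup>2 \<le> (norm (x - y))\<^sup>2"
proof -
  have s: "0 \<le> (norm (x + s *\<^sub>R \<theta> *\<^sub>R y))\<^sup>2 / \<theta>" for s using assms by simp
  have e: "(norm (x + s *\<^sub>R \<theta> *\<^sub>R y))\<^sup>2 / \<theta> = (norm x)\<^sup>2 / \<theta> + 2 * s * (x \<bullet> y) + s\<^sup>2 * \<theta> * (norm y)\<^sup>2" for s
    unfolding power2_norm_eq_inner using assms
    by (simp add: inner_add inner_commute add_divide_distrib algebra_simps power2_eq_square)
  have d: "(norm (x - y))\<^sup>2 = (norm x)\<^sup>2 + (norm y)\<^sup>2 - 2 * (x \<bullet> y)"
    by (simp add: power2_norm_eq_inner inner_diff inner_commute)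
  show "(norm (x - y))\<^sup>2 \<le> (1 + 1 / \<theta>) * (norm x)\<^sup>2 + (1 + \<theta>) * (norm y)\<^sup>2"
    using s[of 1] unfolding e d by (simp add: algebra_simps)
  show "(1 - \<theta>) * (norm y)\<^sup>2 - (1 / \<theta> - 1) * (norm x)\<^sup>2 \<le> (norm (x - y))\<^sup>2"
    using s[of "-1"] unfolding e d by (simp add: algebra_simps)
qed

lemma coupling_D:
  assumes "\<gamma> \<in> couplings \<mu> \<nu>"
  shows "prob_space \<gamma>" "sets \<gamma> = sets borel" "distr \<gamma> borel fst = \<mu>" "distr \<gamma> borel snd = \<nu>" "space \<gamma> = UNIV"
  using assms sets_eq_imp_space_eq[of \<gamma> borel] by (auto simp: couplings_def)

lemma measurable_fst_snd_borel:
  assumes "sets \<gamma> = sets (borel :: ('a::second_countable_topology \<times> 'b::second_countable_topology) measure)"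
  shows "fst \<in> measurable \<gamma> (borel :: 'a measure)" "snd \<in> measurable \<gamma> (borel :: 'b measure)"
  by (intro borel_measurable_continuous_sets[OF assms] continuous_on_fst continuous_on_snd continuous_on_id)+

lemma coupling_P2:
  fixes \<mu> \<nu> :: "'a::euclidean_space measure"
  assumes \<gamma>: "\<gamma> \<in> couplings \<mu> \<nu>" and \<mu>: "\<mu> \<in> P2" and \<nu>: "\<nu> \<in> P2"
  shows "\<gamma> \<in> P2" "integrable \<gamma> (\<lambda>z. (norm (fst z))\<^sup>2)" "integrable \<gamma> (\<lambda>z. (norm (snd z))\<^sup>2)"
    "(\<integral>z. (norm (fst z))\<^sup>2 \<partial>\<gamma>) = (\<integral>x. (norm x)\<^sup>2 \<partial>\<mu>)"
    "(\<integral>z. (norm (snd z))\<^sup>2 \<partial>\<gamma>) = (\<integral>x. (norm x)\<^sup>2 \<partial>\<nu>)"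
    "(\<integral>z. (norm z)\<^sup>2 \<partial>\<gamma>) = (\<integral>x. (norm x)\<^sup>2 \<partial>\<mu>) + (\<integral>x. (norm x)\<^sup>2 \<partial>\<nu>)"
    "integrable \<gamma> (\<lambda>z. (norm (fst z - snd z))\<^sup>2)"
proof -
  note c = coupling_D[OF \<gamma>]
  note m = measurable_fst_snd_borel[OF c(2)]
  show i1: "integrable \<gamma> (\<lambda>z. (norm (fst z))\<^sup>2)"
    using P2_D(3)[OF \<mu>] unfolding c(3)[symmetric] by (subst (asm) integrable_distr_eq[OF m(1)]) auto
  show i2: "integrable \<gamma> (\<lambda>z. (norm (snd z))\<^sup>2)"
    using P2_D(3)[OF \<nu>] unfolding c(4)[symmetric] by (subst (asm) integrable_distr_eq[OF m(2)]) auto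
  show e1: "(\<integral>z. (norm (fst z))\<^sup>2 \<partial>\<gamma>) = (\<integral>x. (norm x)\<^sup>2 \<partial>\<mu>)"
    unfolding c(3)[symmetric] by (subst integral_distr[OF m(1)]) auto
  show e2: "(\<integral>z. (norm (snd z))\<^sup>2 \<partial>\<gamma>) = (\<integral>x. (norm x)\<^sup>2 \<partial>\<nu>)"
    unfolding c(4)[symmetric] by (subst integral_distr[OF m(2)]) auto
  have sq: "(norm z)\<^sup>2 = (norm (fst z))\<^sup>2 + (norm (snd z))\<^sup>2" for z :: "'a \<times> 'a"
    using norm_Pair_power2[of "fst z" "snd z"] by simp
  show "\<gamma> \<in> P2" unfolding P2_def sq using c i1 i2 by simp
  show "(\<integral>z. (norm z)\<^sup>2 \<partial>\<gamma>) = (\<integral>x. (norm x)\<^sup>2 \<partial>\<mu>) + (\<integral>x. (norm x)\<^sup>2 \<partial>\<nu>)"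
    unfolding sq e1[symmetric] e2[symmetric] using i1 i2 by simp
  show "integrable \<gamma> (\<lambda>z. (norm (fst z - snd z))\<^sup>2)"
    by (rule integrable_of_bound[where g="\<lambda>z. 2 * (norm (fst z))\<^sup>2 + 2 * (norm (snd z))\<^sup>2"])
      (use c i1 i2 norm_diff_power2_le in \<open>auto intro!: continuous_intros\<close>)
qed

lemma pair_coupling:
  fixes \<mu> \<nu> :: "'a::euclidean_space measure"
  assumes \<mu>: "\<mu> \<in> P2" and \<nu>: "\<nu> \<in> P2"
  shows "\<mu> \<Otimes>\<^sub>M \<nu> \<in> couplings \<mu> \<nu>"
proof -
  interpret \<mu>: prob_space \<mu> by (rule P2_D[OF \<mu>])
  interpret \<nu>: prob_space \<nu> by (rule P2_D[OF \<nu>])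
  interpret pair_prob_space \<mu> \<nu> ..
  have s: "sets (\<mu> \<Otimes>\<^sub>M \<nu>) = sets borel"
    using sets_pair_measure_cong[OF P2_D(2)[OF \<mu>] P2_D(2)[OF \<nu>]] unfolding borel_prod .
  note m = measurable_fst_snd_borel[OF s]
  have "distr (\<mu> \<Otimes>\<^sub>M \<nu>) borel fst = \<mu>"
    using \<nu>.distr_pair_fst[of \<mu>] distr_cong[OF refl P2_D(2)[OF \<mu>], of "\<mu> \<Otimes>\<^sub>M \<nu>" fst fst] by simp
  moreover have "distr (\<mu> \<Otimes>\<^sub>M \<nu>) borel snd = \<nu>"
  proof (rule measure_eqI)
    fix A assume "A \<in> sets (distr (\<mu> \<Otimes>\<^sub>M \<nu>) borel snd)"
    then have A: "A \<in> sets borel" by simp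
    have "snd -` A \<inter> space (\<mu> \<Otimes>\<^sub>M \<nu>) = space \<mu> \<times> A"
      using P2_D(4)[OF \<mu>] P2_D(4)[OF \<nu>] by (auto simp: space_pair_measure)
    then have "emeasure (distr (\<mu> \<Otimes>\<^sub>M \<nu>) borel snd) A = emeasure (\<mu> \<Otimes>\<^sub>M \<nu>) (space \<mu> \<times> A)"
      using A by (simp add: emeasure_distr[OF m(2)])
    also have "\<dots> = emeasure \<mu> (space \<mu>) * emeasure \<nu> A"
      using A P2_D(2)[OF \<nu>] by (intro \<nu>.emeasure_pair_measure_Times) auto
    finally show "emeasure (distr (\<mu> \<Otimes>\<^sub>M \<nu>) borel snd) A = emeasure \<nu> A"
      by (simp add: \<mu>.emeasure_space_1)
  qed (simp add: P2_D(2)[OF \<nu>])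
  ultimately show ?thesis using s prob_space_axioms by (simp add: couplings_def)
qed

section \<open>Generalized geodesics from a Dirac mass and interpolation along couplings\<close>

lemma optimal_plan_return:
  fixes \<nu> :: "'a::euclidean_space measure"
  assumes \<nu>: "\<nu> \<in> P2" and \<gamma>: "\<gamma> \<in> couplings (return borel 0) \<nu>"
  shows "optimal_plan (return borel 0) \<nu> \<gamma>"
proof -
  \<comment> \<open>In a coupling with the Dirac mass at 0 the first coordinate vanishes almost
    surely, so all such couplings have the same cost, the second moment of
    \<open>\<nu>\<close>.\<close>
  have cost: "(\<integral>(x, y). (norm (x - y))\<^sup>2 \<partial>\<gamma>') = (\<integral>y. (norm y)\<^sup>2 \<partial>\<nu>)"
    if \<gamma>': "\<gamma>' \<in> couplings (return borel 0) \<nu>" for \<gamma>'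
  proof -
    note c = coupling_D[OF \<gamma>']
    note m = measurable_fst_snd_borel[OF c(2)]
    have "AE x in distr \<gamma>' borel fst. x = 0"
      unfolding c(3) by (subst AE_return) (auto simp: pred_def)
    then have "AE z in \<gamma>'. fst z = 0"
      by (subst (asm) AE_distr_iff[OF m(1)]) auto
    then have "(\<integral>z. (norm (fst z - snd z))\<^sup>2 \<partial>\<gamma>') = (\<integral>z. (norm (snd z))\<^sup>2 \<partial>\<gamma>')"
      by (intro integral_cong_AE)
        (auto intro!: borel_measurable_continuous_sets[OF c(2)] continuous_intros elim!: eventually_mono)
    then show ?thesis
      using coupling_P2(5)[OF \<gamma>' return_0_P2 \<nu>] by (simp add: split_beta')
  qed
  show ?thesis unfolding optimal_plan_def using \<gamma> cost by simp
qed

text \<open>With a Dirac mass as base point the optimality conditions are void.\<close>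

lemma generalized_geodesic_convexity_coupling:
  fixes F :: "'a::euclidean_space measure \<Rightarrow> ereal"
  assumes conv: "convex_along_generalized_geodesics l F"
    and \<nu>: "\<nu> \<in> P2" and \<rho>: "\<rho> \<in> P2" and \<gamma>: "\<gamma> \<in> couplings \<nu> \<rho>" and t: "t \<in> {0..1}"
  shows "F (distr \<gamma> borel (\<lambda>z. t *\<^sub>R snd z + (1 - t) *\<^sub>R fst z)) \<le>
    ereal t * F \<rho> + ereal (1 - t) * F \<nu> - ereal (l / 2 * t * (1 - t) * (\<integral>z. (norm (fst z - snd z))\<^sup>2 \<partial>\<gamma>))"
proof -
  note c = coupling_D[OF \<gamma>]
  interpret prob_space \<gamma> by (rule c)
  note m = measurable_fst_snd_borel[OF c(2)]
  \<comment> \<open>Prepending the constant 0 turns the Dirac mass into the base point of the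
    definition, while the other two coordinates carry \<open>\<gamma>\<close> itself.\<close>
  define j :: "'a \<times> 'a \<Rightarrow> 'a \<times> 'a \<times> 'a" where "j z = (0, z)" for z
  have jc: "continuous_on UNIV j" unfolding j_def by (intro continuous_intros)
  have jm: "j \<in> measurable \<gamma> borel" by (rule borel_measurable_continuous_sets[OF c(2) jc])
  define \<Gamma> where "\<Gamma> = distr \<gamma> borel j"
  have "\<gamma> \<in> P2" by (rule coupling_P2(1)[OF \<gamma> \<nu> \<rho>])
  then have \<Gamma>: "\<Gamma> \<in> P2"
    unfolding \<Gamma>_def by (rule P2_distr[where C=1]) (auto simp: jc, simp add: j_def norm_Pair_power2)
  have dd: "distr \<Gamma> borel h = distr \<gamma> borel (h \<circ> j)" if "continuous_on UNIV h" for h :: "_ \<Rightarrow> 'b::euclidean_space"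
    unfolding \<Gamma>_def by (rule distr_distr[OF borel_measurable_continuous_onI[OF that] jm])
  have opt: "optimal_plan (return borel 0) \<sigma> (distr \<gamma> borel (\<lambda>z. (0, p z)))"
    if p: "continuous_on UNIV p" "distr \<gamma> borel p = \<sigma>" "\<sigma> \<in> P2" for p :: "_ \<Rightarrow> 'a" and \<sigma>
  proof (rule optimal_plan_return[OF p(3)])
    have pm: "(\<lambda>z. (0 :: 'a, p z)) \<in> measurable \<gamma> borel"
      by (rule borel_measurable_continuous_sets[OF c(2)]) (intro continuous_intros p)
    have "distr (distr \<gamma> borel (\<lambda>z. (0 :: 'a, p z))) borel fst = return borel 0"
      by (subst distr_distr[OF measurable_fst_snd_borel(1)[OF refl] pm]) (simp add: comp_def)
    moreover have "distr (distr \<gamma> borel (\<lambda>z. (0 :: 'a, p z))) borel snd = \<sigma>"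
      by (subst distr_distr[OF measurable_fst_snd_borel(2)[OF refl] pm]) (simp add: comp_def p(2))
    ultimately show "distr \<gamma> borel (\<lambda>z. (0, p z)) \<in> couplings (return borel 0) \<sigma>"
      using prob_space_distr[OF pm] by (simp add: couplings_def)
  qed
  have o1: "optimal_plan (return borel 0) \<nu> (distr \<Gamma> borel (\<lambda>(x, y, z). (x, y)))"
    using opt[OF continuous_on_fst[OF continuous_on_id] c(3) \<nu>]
    by (subst dd) (auto simp: split_beta' comp_def j_def intro!: continuous_intros)
  have o2: "optimal_plan (return borel 0) \<rho> (distr \<Gamma> borel (\<lambda>(x, y, z). (x, z)))"
    using opt[OF continuous_on_snd[OF continuous_on_id] c(4) \<rho>]
    by (subst dd) (auto simp: split_beta' comp_def j_def intro!: continuous_intros)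
  have e1: "distr \<Gamma> borel (\<lambda>(x, y, z). t *\<^sub>R z + (1 - t) *\<^sub>R y) = distr \<gamma> borel (\<lambda>z. t *\<^sub>R snd z + (1 - t) *\<^sub>R fst z)"
    by (subst dd) (auto simp: split_beta' comp_def j_def intro!: continuous_intros)
  have "distr \<Gamma> borel (\<lambda>(x, y, z). (y, z)) = distr \<gamma> borel (\<lambda>z. z)"
    by (subst dd) (auto simp: split_beta' comp_def j_def intro!: continuous_intros)
  also have "\<dots> = \<gamma>" using distr_id2[OF c(2)[symmetric]] by simp
  finally have e2: "distr \<Gamma> borel (\<lambda>(x, y, z). (y, z)) = \<gamma>" .
  have "F (distr \<Gamma> borel (\<lambda>(x, y, z). t *\<^sub>R z + (1 - t) *\<^sub>R y))
           \<le> ereal t * F \<rho> + ereal (1 - t) * F \<nu>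
             - ereal (l / 2 * t * (1 - t) *
                 (\<integral>(y, z). (norm (y - z))\<^sup>2 \<partial>(distr \<Gamma> borel (\<lambda>(x, y, z). (y, z)))))"
    using conv[unfolded convex_along_generalized_geodesics_def, rule_format,
      OF return_0_P2 \<nu> \<rho> \<Gamma> conjI[OF o1 o2] t] .
  then show ?thesis unfolding e1 e2 by (simp add: split_beta')
qed

text \<open>Following each segment for the time \<open>t\<close> scales displacements by
  \<open>t\<close>, whence the factor \<open>t\<^sup>2\<close>. The coupling \<open>\<kappa>\<close>
  need not be optimal; it bounds from above how far \<open>\<sigma>\<close> is from
  \<open>\<nu>\<close>.\<close>

lemma interpolation_coupling:
  fixes \<nu> \<rho> :: "'a::euclidean_space measure" and t :: real
  assumes \<nu>: "\<nu> \<in> P2" and \<rho>: "\<rho> \<in> P2" and \<gamma>: "\<gamma> \<in> couplings \<nu> \<rho>"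
  defines "\<sigma> \<equiv> distr \<gamma> borel (\<lambda>z. t *\<^sub>R snd z + (1 - t) *\<^sub>R fst z)"
    and "\<kappa> \<equiv> distr \<gamma> borel (\<lambda>z. (fst z, t *\<^sub>R snd z + (1 - t) *\<^sub>R fst z))"
  shows "\<sigma> \<in> P2" "\<kappa> \<in> couplings \<nu> \<sigma>"
    "(\<integral>z. (norm (fst z - snd z))\<^sup>2 \<partial>\<kappa>) = t\<^sup>2 * (\<integral>z. (norm (fst z - snd z))\<^sup>2 \<partial>\<gamma>)"
proof -
  note c = coupling_D[OF \<gamma>]
  interpret prob_space \<gamma> by (rule c)
  have pm: "(\<lambda>z. (fst z, t *\<^sub>R snd z + (1 - t) *\<^sub>R fst z)) \<in> measurable \<gamma> borel"
    by (rule borel_measurable_continuous_sets[OF c(2)]) (intro continuous_intros)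
  have "distr \<kappa> borel fst = \<nu>" unfolding \<kappa>_def
    by (subst distr_distr[OF measurable_fst_snd_borel(1)[OF refl] pm]) (simp add: comp_def c(3))
  moreover have "distr \<kappa> borel snd = \<sigma>" unfolding \<kappa>_def \<sigma>_def
    by (subst distr_distr[OF measurable_fst_snd_borel(2)[OF refl] pm]) (simp add: comp_def)
  ultimately show "\<kappa> \<in> couplings \<nu> \<sigma>"
    using prob_space_distr[OF pm] by (simp add: couplings_def \<kappa>_def)
  show "\<sigma> \<in> P2" unfolding \<sigma>_def
  proof (rule P2_distr[OF coupling_P2(1)[OF \<gamma> \<nu> \<rho>], where C="2 * t\<^sup>2 + 2 * (1 - t)\<^sup>2"])
    show "continuous_on UNIV (\<lambda>z :: 'a \<times> 'a. t *\<^sub>R snd z + (1 - t) *\<^sub>R fst z)" by (intro continuous_intros)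
    fix z :: "'a \<times> 'a"
    have "(norm (t *\<^sub>R snd z + (1 - t) *\<^sub>R fst z))\<^sup>2 \<le> 2 * (norm (t *\<^sub>R snd z))\<^sup>2 + 2 * (norm ((1 - t) *\<^sub>R fst z))\<^sup>2"
      using norm_diff_power2_le[of "t *\<^sub>R snd z" "- ((1 - t) *\<^sub>R fst z)"] by simp
    also have "\<dots> = 2 * t\<^sup>2 * (norm (snd z))\<^sup>2 + 2 * (1 - t)\<^sup>2 * (norm (fst z))\<^sup>2"
      by (simp add: power_mult_distrib)
    also have "\<dots> \<le> (2 * t\<^sup>2 + 2 * (1 - t)\<^sup>2) * ((norm (snd z))\<^sup>2 + (norm (fst z))\<^sup>2)"
      by (simp add: algebra_simps)
    also have "(norm (snd z))\<^sup>2 + (norm (fst z))\<^sup>2 = (norm z)\<^sup>2"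
      using norm_Pair_power2[of "fst z" "snd z"] by simp
    finally show "(norm (t *\<^sub>R snd z + (1 - t) *\<^sub>R fst z))\<^sup>2 \<le> (2 * t\<^sup>2 + 2 * (1 - t)\<^sup>2) * (norm z)\<^sup>2" .
  qed
  have "(\<integral>z. (norm (fst z - snd z))\<^sup>2 \<partial>\<kappa>) = (\<integral>z. (norm (fst z - (t *\<^sub>R snd z + (1 - t) *\<^sub>R fst z)))\<^sup>2 \<partial>\<gamma>)"
    unfolding \<kappa>_def by (subst integral_distr[OF pm])
      (auto intro!: borel_measurable_continuous_onI continuous_intros)
  also have "\<dots> = (\<integral>z. t\<^sup>2 * (norm (fst z - snd z))\<^sup>2 \<partial>\<gamma>)"
  proof (intro Bochner_Integration.integral_cong refl)
    fix z :: "'a \<times> 'a"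
    have "fst z - (t *\<^sub>R snd z + (1 - t) *\<^sub>R fst z) = t *\<^sub>R (fst z - snd z)"
      by (simp add: algebra_simps)
    then show "(norm (fst z - (t *\<^sub>R snd z + (1 - t) *\<^sub>R fst z)))\<^sup>2 = t\<^sup>2 * (norm (fst z - snd z))\<^sup>2"
      by (simp add: power_mult_distrib)
  qed
  finally show "(\<integral>z. (norm (fst z - snd z))\<^sup>2 \<partial>\<kappa>) = t\<^sup>2 * (\<integral>z. (norm (fst z - snd z))\<^sup>2 \<partial>\<gamma>)" by simp
qed

text \<open>The test function is merely continuous, so uniform continuity is available on balls
  only. Points far from the origin and large displacements are absorbed by quadratic terms, as in
  Chebyshev's inequality.\<close>

lemma narrowly_converges_if_cost_tendsto_0:
  fixes \<nu> :: "'a::euclidean_space measure"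
  assumes \<nu>: "\<nu> \<in> P2" and \<sigma>: "\<And>n. \<sigma> n \<in> P2" and \<kappa>: "\<And>n. \<kappa> n \<in> couplings \<nu> (\<sigma> n)"
    and lim: "(\<lambda>n. \<integral>z. (norm (fst z - snd z))\<^sup>2 \<partial>\<kappa> n) \<longlonglongrightarrow> 0"
  shows "narrowly_converges \<sigma> \<nu>"
  unfolding narrowly_converges_def
proof (intro allI impI, elim conjE)
  fix f :: "'a \<Rightarrow> real" assume fc: "continuous_on UNIV f" and fb: "bounded (range f)"
  obtain B where B: "B > 0" "\<And>x. \<bar>f x\<bar> \<le> B" using fb unfolding bounded_pos by auto
  define m where "m = (\<integral>x. (norm x)\<^sup>2 \<partial>\<nu>)"
  define D where "D n = (\<integral>z. (norm (fst z - snd z))\<^sup>2 \<partial>\<kappa> n)" for n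
  have m0: "0 \<le> m" unfolding m_def by (intro integral_nonneg_AE) auto
  show "(\<lambda>n. \<integral>x. f x \<partial>\<sigma> n) \<longlonglongrightarrow> (\<integral>x. f x \<partial>\<nu>)"
  proof (rule LIMSEQ_I)
    fix \<epsilon> :: real assume "\<epsilon> > 0"
    define e where "e = \<epsilon> / 4"
    have e: "e > 0" using \<open>\<epsilon> > 0\<close> by (simp add: e_def)
    \<comment> \<open>Chosen so that the tail term \<open>2 * B / R\<^sup>2 * m\<close> is at most
      \<open>e\<close>; using \<open>m + 1\<close> keeps \<open>R\<close> positive when
      \<open>m = 0\<close>.\<close>
    define R where "R = sqrt (2 * B * (m + 1) / e)"
    have R: "R > 0" using B e m0 by (simp add: R_def)
    have R2: "2 * B / R\<^sup>2 * m \<le> e"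
    proof -
      have "R\<^sup>2 = 2 * B * (m + 1) / e" using B e m0 by (simp add: R_def)
      then have "2 * B / R\<^sup>2 * m = e * (m / (m + 1))" using B e by simp
      also have "\<dots> \<le> e * 1" using m0 e by (intro mult_left_mono) auto
      finally show ?thesis by simp
    qed
    \<comment> \<open>The radius is \<open>R + 1\<close> because displacements will be below
      \<open>d <= 1\<close>, so that the displaced point stays in the ball.\<close>
    have "uniformly_continuous_on (cball 0 (R + 1)) f"
      using fc by (intro compact_uniformly_continuous continuous_on_subset[OF fc]) auto
    then obtain d0 where d0: "d0 > 0" "\<And>x x'. x \<in> cball 0 (R + 1) \<Longrightarrow> x' \<in> cball 0 (R + 1) \<Longrightarrow> dist x' x < d0 \<Longrightarrow> dist (f x') (f x) < e"
      using e unfolding uniformly_continuous_on_def by metis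
    define d where "d = min d0 1"
    have d: "d > 0" "d \<le> d0" "d \<le> 1" using d0 by (auto simp: d_def)
    have pw: "\<bar>f y' - f y\<bar> \<le> e + 2 * B / R\<^sup>2 * (norm y)\<^sup>2 + 2 * B / d\<^sup>2 * (norm (y - y'))\<^sup>2" for y y'
    proof -
      have nn: "0 \<le> 2 * B / R\<^sup>2 * (norm y)\<^sup>2" "0 \<le> 2 * B / d\<^sup>2 * (norm (y - y'))\<^sup>2" using B by auto
      have far: "\<bar>f y' - f y\<bar> \<le> 2 * B" using B(2)[of y] B(2)[of y'] by linarith
      have big: "2 * B \<le> 2 * B / s\<^sup>2 * u\<^sup>2" if "0 < s" "s \<le> u" for s u :: real
      proof -
        have "s\<^sup>2 \<le> u\<^sup>2" using that by (intro power_mono) auto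
        then have "1 \<le> u\<^sup>2 / s\<^sup>2" using that by simp
        then have "2 * B * 1 \<le> 2 * B * (u\<^sup>2 / s\<^sup>2)" using B by (intro mult_left_mono) auto
        then show ?thesis by simp
      qed
      consider "R \<le> norm y" | "d \<le> norm (y - y')" | "norm y < R" "norm (y - y') < d" by linarith
      then show ?thesis
      proof cases
        case 1
        then show ?thesis using big[OF R 1] far nn e by linarith
      next
        case 2
        then show ?thesis using big[OF d(1) 2] far nn e by linarith
      next
        case 3
        have "norm y' \<le> norm y + norm (y - y')"
          using norm_triangle_ineq4[of y "y - y'"] by simp
        then have "y \<in> cball 0 (R + 1)" "y' \<in> cball 0 (R + 1)" using 3 d by auto
        moreover have "dist y' y < d0" using 3(2) d by (simp add: dist_norm norm_minus_commute)
        ultimately have "\<bar>f y' - f y\<bar> < e" using d0(2)[of y y'] by (simp add: dist_real_def)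
        then show ?thesis using nn by linarith
      qed
    qed
    have est: "\<bar>(\<integral>x. f x \<partial>\<sigma> n) - (\<integral>x. f x \<partial>\<nu>)\<bar> \<le> 2 * e + 2 * B / d\<^sup>2 * D n" for n
    proof -
      note c = coupling_D[OF \<kappa>[of n]]
      interpret prob_space "\<kappa> n" by (rule c)
      note ms = measurable_fst_snd_borel[OF c(2)]
      have fm: "f \<in> borel_measurable borel" using fc by (rule borel_measurable_continuous_onI)
      have fs: "continuous_on UNIV (\<lambda>z :: 'a \<times> 'a. f (fst z))" "continuous_on UNIV (\<lambda>z :: 'a \<times> 'a. f (snd z))"
        by (auto intro!: continuous_on_compose2[OF fc] continuous_intros)
      have i1: "integrable (\<kappa> n) (\<lambda>z. f (fst z))" and i2: "integrable (\<kappa> n) (\<lambda>z. f (snd z))"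
        using B fs by (auto intro!: integrable_const_bound[where B=B] borel_measurable_continuous_sets[OF c(2)])
      have i3: "integrable (\<kappa> n) (\<lambda>z. e + 2 * B / R\<^sup>2 * (norm (fst z))\<^sup>2 + 2 * B / d\<^sup>2 * (norm (fst z - snd z))\<^sup>2)"
        using coupling_P2(2,7)[OF \<kappa>[of n] \<nu> \<sigma>] by (intro Bochner_Integration.integrable_add integrable_mult_right) auto
      have "(\<integral>x. f x \<partial>\<sigma> n) - (\<integral>x. f x \<partial>\<nu>) = (\<integral>z. f (snd z) - f (fst z) \<partial>\<kappa> n)"
        using i1 i2 integral_distr[OF ms(1) fm] integral_distr[OF ms(2) fm] by (simp add: c(3,4))
      also have "\<bar>\<dots>\<bar> \<le> (\<integral>z. \<bar>f (snd z) - f (fst z)\<bar> \<partial>\<kappa> n)" by (rule integral_abs_bound)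
      also have "\<dots> \<le> (\<integral>z. e + 2 * B / R\<^sup>2 * (norm (fst z))\<^sup>2 + 2 * B / d\<^sup>2 * (norm (fst z - snd z))\<^sup>2 \<partial>\<kappa> n)"
        using i1 i2 pw by (intro integral_mono i3) auto
      also have "\<dots> = e + 2 * B / R\<^sup>2 * m + 2 * B / d\<^sup>2 * D n"
        using coupling_P2(2,4,7)[OF \<kappa>[of n] \<nu> \<sigma>] by (simp add: prob_space m_def D_def)
      finally show ?thesis using R2 by linarith
    qed
    have "(\<lambda>n. 2 * B / d\<^sup>2 * D n) \<longlonglongrightarrow> 2 * B / d\<^sup>2 * 0"
      using lim unfolding D_def by (intro tendsto_mult tendsto_const)
    then have "eventually (\<lambda>n. 2 * B / d\<^sup>2 * D n < e) sequentially"
      using e by (intro order_tendstoD(2)) auto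
    then obtain N where N: "\<And>n. n \<ge> N \<Longrightarrow> 2 * B / d\<^sup>2 * D n < e" by (auto simp: eventually_sequentially)
    show "\<exists>N. \<forall>n\<ge>N. norm ((\<integral>x. f x \<partial>\<sigma> n) - (\<integral>x. f x \<partial>\<nu>)) < \<epsilon>"
    proof (intro exI allI impI)
      fix n assume "n \<ge> N"
      then show "norm ((\<integral>x. f x \<partial>\<sigma> n) - (\<integral>x. f x \<partial>\<nu>)) < \<epsilon>"
        using est[of n] N[of n] e unfolding real_norm_def e_def by linarith
    qed
  qed
qed

section \<open>Existence of minimizers\<close>

text \<open>If the bound failed along \<open>\<rho> n\<close>, then moving from \<open>\<nu>\<close> towards \<open>\<rho> n\<close> by the time
  \<open>t n = 1 / sqrt ((n + 1) * (1 + M n))\<close>, where \<open>M n\<close> is the second moment of \<open>\<rho> n\<close>, would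
  converge to \<open>\<nu>\<close> while lowering \<open>F\<close> by a fixed amount.\<close>

lemma quadratic_lower_bound:
  fixes F :: "'a::euclidean_space measure \<Rightarrow> ereal"
  assumes F: "\<And>\<rho>. \<rho> \<in> P2 \<Longrightarrow> F \<rho> \<noteq> -\<infinity>"
    and conv: "convex_along_generalized_geodesics l F" and lsc: "lsc_narrow_bounded_moments F"
    and \<nu>: "\<nu> \<in> P2" and F\<nu>: "\<bar>F \<nu>\<bar> \<noteq> \<infinity>" and a: "a > max (- l) 0 / 2"
  shows "\<exists>C. \<forall>\<rho> \<in> P2. ereal (- a * (\<integral>x. (norm x)\<^sup>2 \<partial>\<rho>) - C) \<le> F \<rho>"
proof (rule ccontr)
  assume "\<not> ?thesis"
  then have "\<forall>n. \<exists>\<rho> \<in> P2. F \<rho> < ereal (- a * (\<integral>x. (norm x)\<^sup>2 \<partial>\<rho>) - real n)"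
    by (meson not_le)
  then obtain \<rho> where \<rho>: "\<And>n. \<rho> n \<in> P2" "\<And>n. F (\<rho> n) < ereal (- a * (\<integral>x. (norm x)\<^sup>2 \<partial>\<rho> n) - real n)"
    by metis
  define L where "L = max (- l) 0"
  define M where "M n = (\<integral>x. (norm x)\<^sup>2 \<partial>\<rho> n)" for n
  define m where "m = (\<integral>x. (norm x)\<^sup>2 \<partial>\<nu>)"
  define \<gamma> where "\<gamma> n = \<nu> \<Otimes>\<^sub>M \<rho> n" for n
  define D where "D n = (\<integral>z. (norm (fst z - snd z))\<^sup>2 \<partial>\<gamma> n)" for n
  \<comment> \<open>Small enough that \<open>L / 2 * \<theta>\<close> uses at most half of the gap
    \<open>a - L / 2\<close>; the denominator \<open>L + 1\<close> avoids division by zero.\<close>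
  define \<theta> where "\<theta> = (a - L / 2) / (L + 1)"
  define c where "c = (1 + 1 / \<theta>) * m"
  \<comment> \<open>The fixed amount by which \<open>F\<close> will drop: a common rate for the
    growth in \<open>M n\<close> and in \<open>n\<close>. The cap \<open>1 / 2\<close> leaves the
    other half of \<open>n\<close> to absorb the constant \<open>L * c / 2\<close>.\<close>
  define b where "b = min (a - L / 2 * (1 + \<theta>)) (1 / 2)"
  define t where "t n = 1 / sqrt (real (Suc n) * (1 + M n))" for n
  define \<sigma> where "\<sigma> n = distr (\<gamma> n) borel (\<lambda>z. t n *\<^sub>R snd z + (1 - t n) *\<^sub>R fst z)" for n
  define \<kappa> where "\<kappa> n = distr (\<gamma> n) borel (\<lambda>z. (fst z, t n *\<^sub>R snd z + (1 - t n) *\<^sub>R fst z))" for n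
  obtain f where f: "F \<nu> = ereal f" using F\<nu> by (cases "F \<nu>") auto
  have L: "L \<ge> 0" "- l \<le> L" "L / 2 < a" using a by (auto simp: L_def)
  have \<theta>: "\<theta> > 0" using L by (simp add: \<theta>_def)
  have m0: "0 \<le> m" and M0: "0 \<le> M n" for n
    unfolding m_def M_def by (auto intro!: integral_nonneg_AE)
  have c0: "0 \<le> c" using m0 \<theta> by (simp add: c_def)
  have b: "b > 0"
  proof -
    have "L / 2 * \<theta> = (a - L / 2) * (L / (L + 1)) / 2" by (simp add: \<theta>_def mult_ac)
    also have "\<dots> \<le> (a - L / 2) * 1 / 2"
      using L by (intro divide_right_mono mult_left_mono) auto
    finally have "L / 2 * \<theta> \<le> (a - L / 2) / 2" by simp
    then have "a - L / 2 * (1 + \<theta>) > 0" using L by (simp add: distrib_left)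
    then show ?thesis by (simp add: b_def)
  qed
  have \<gamma>: "\<gamma> n \<in> couplings \<nu> (\<rho> n)" for n unfolding \<gamma>_def by (rule pair_coupling[OF \<nu> \<rho>(1)])
  note ip = interpolation_coupling[OF \<nu> \<rho>(1) \<gamma>]
  have D0: "0 \<le> D n" for n unfolding D_def by (auto intro!: integral_nonneg_AE)
  have D: "D n \<le> (1 + \<theta>) * M n + c" for n
  proof -
    note i = coupling_P2[OF \<gamma>[of n] \<nu> \<rho>(1)]
    have "D n \<le> (\<integral>z. (1 + 1 / \<theta>) * (norm (fst z))\<^sup>2 + (1 + \<theta>) * (norm (snd z))\<^sup>2 \<partial>\<gamma> n)"
      unfolding D_def using i norm_diff_power2_le_eps(1)[OF \<theta>] by (intro integral_mono) auto
    also have "\<dots> = c + (1 + \<theta>) * M n" using i by (simp add: c_def M_def m_def)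
    finally show ?thesis by simp
  qed
  have uv: "1 \<le> real (Suc n) * (1 + M n)" for n
    using mult_mono[of 1 "real (Suc n)" 1 "1 + M n"] M0[of n] by simp
  have t: "0 < t n" "t n \<le> 1" "(t n)\<^sup>2 = 1 / (real (Suc n) * (1 + M n))" "t n \<le> 1 / sqrt (real (Suc n))" for n
  proof -
    have s: "1 \<le> sqrt (real (Suc n) * (1 + M n))" using uv[of n] by simp
    then show "0 < t n" "t n \<le> 1" unfolding t_def by auto
    show "(t n)\<^sup>2 = 1 / (real (Suc n) * (1 + M n))"
      using M0[of n] by (simp add: t_def power_divide)
    have "real (Suc n) * 1 \<le> real (Suc n) * (1 + M n)" using M0[of n] by (intro mult_left_mono) auto
    then show "t n \<le> 1 / sqrt (real (Suc n))" unfolding t_def using s by (intro divide_left_mono) auto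
  qed
  have cost: "(\<integral>z. (norm (fst z - snd z))\<^sup>2 \<partial>\<kappa> n) = (t n)\<^sup>2 * D n" for n
    unfolding \<kappa>_def D_def by (rule ip(3))
  \<comment> \<open>\<open>D n\<close> grows at most linearly in \<open>1 + M n\<close>, which one
    factor in the denominator of \<open>(t n)\<^sup>2\<close> cancels; the other factor sends the
    cost to 0.\<close>
  have cost_le: "(t n)\<^sup>2 * D n \<le> (1 + \<theta> + c) / real (Suc n)" for n
  proof -
    have "D n \<le> (1 + \<theta> + c) * (1 + M n)"
      using D[of n] M0[of n] c0 \<theta> by (simp add: algebra_simps) (smt (verit) mult_nonneg_nonneg)
    then have "(t n)\<^sup>2 * D n \<le> (t n)\<^sup>2 * ((1 + \<theta> + c) * (1 + M n))" by (intro mult_left_mono) auto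
    also have "\<dots> = (1 + \<theta> + c) / real (Suc n)" using M0[of n] unfolding t(3) by simp
    finally show ?thesis .
  qed
  have cost0: "(\<lambda>n. \<integral>z. (norm (fst z - snd z))\<^sup>2 \<partial>\<kappa> n) \<longlonglongrightarrow> 0"
    unfolding cost
  proof (rule tendsto_sandwich[OF _ _ tendsto_const])
    show "(\<lambda>n. (1 + \<theta> + c) / real (Suc n)) \<longlonglongrightarrow> 0"
      by (rule LIMSEQ_Suc[OF lim_const_over_n])
  qed (use D0 cost_le in auto)
  have narrow: "narrowly_converges \<sigma> \<nu>"
    by (rule narrowly_converges_if_cost_tendsto_0[where \<kappa>=\<kappa>])
      (use \<nu> ip cost0 in \<open>auto simp: \<sigma>_def \<kappa>_def\<close>)
  have bounded: "(\<integral>x. (norm x)\<^sup>2 \<partial>\<sigma> n) \<le> 2 * m + 2 * (1 + \<theta> + c)" for n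
  proof -
    have \<kappa>: "\<kappa> n \<in> couplings \<nu> (\<sigma> n)" and \<sigma>: "\<sigma> n \<in> P2" using ip by (simp_all add: \<kappa>_def \<sigma>_def)
    note i = coupling_P2[OF \<kappa> \<nu> \<sigma>]
    have "(\<integral>x. (norm x)\<^sup>2 \<partial>\<sigma> n) \<le> (\<integral>z. 2 * (norm (fst z))\<^sup>2 + 2 * (norm (fst z - snd z))\<^sup>2 \<partial>\<kappa> n)"
      unfolding i(5)[symmetric]
    proof (rule integral_mono[OF i(3)])
      show "integrable (\<kappa> n) (\<lambda>z. 2 * (norm (fst z))\<^sup>2 + 2 * (norm (fst z - snd z))\<^sup>2)" using i by simp
      fix z :: "'a \<times> 'a"
      show "(norm (snd z))\<^sup>2 \<le> 2 * (norm (fst z))\<^sup>2 + 2 * (norm (fst z - snd z))\<^sup>2"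
        using norm_diff_power2_le[of "fst z" "fst z - snd z"] by simp
    qed
    also have "\<dots> = 2 * m + 2 * ((t n)\<^sup>2 * D n)" using i cost[of n] by (simp add: m_def)
    also have "\<dots> \<le> 2 * m + 2 * (1 + \<theta> + c)"
    proof -
      have "(1 + \<theta> + c) / real (Suc n) \<le> (1 + \<theta> + c) / 1"
        using \<theta> c0 by (intro divide_left_mono) auto
      then show ?thesis using cost_le[of n] by simp
    qed
    finally show ?thesis .
  qed
  have "F \<nu> \<le> liminf (\<lambda>n. F (\<sigma> n))"
    using lsc[unfolded lsc_narrow_bounded_moments_def, rule_format, of \<sigma> \<nu>] \<nu> ip(1) narrow bounded
    by (auto simp: \<sigma>_def)
  also have "\<dots> \<le> liminf (\<lambda>n. ereal ((1 - t n) * f - b))"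
  proof (rule Liminf_mono)
    \<comment> \<open>From this index on, \<open>(n + 1) / 2 <= n - L * c / 2\<close>.\<close>
    obtain N where N: "L * c + 1 \<le> real N" using real_arch_simple by blast
    have "F (\<sigma> n) \<le> ereal ((1 - t n) * f - b)" if "n \<ge> N" for n
    proof -
      have tn: "t n \<in> {0..1}" using t(1,2)[of n] by simp
      obtain g where g: "F (\<rho> n) = ereal g" "g < - a * M n - real n"
        using \<rho>(2)[of n] F[OF \<rho>(1)[of n]] by (cases "F (\<rho> n)") (auto simp: M_def)
      have "F (\<sigma> n) \<le> ereal (t n * g + (1 - t n) * f - l / 2 * t n * (1 - t n) * D n)"
        using generalized_geodesic_convexity_coupling[OF conv \<nu> \<rho>(1) \<gamma>[of n] tn]
        by (simp add: \<sigma>_def D_def g(1) f)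
      also have "t n * g + (1 - t n) * f - l / 2 * t n * (1 - t n) * D n \<le> (1 - t n) * f - b"
      proof -
        have "- l / 2 * ((1 - t n) * D n) \<le> L / 2 * ((1 - t n) * D n)"
          using L(2) D0[of n] tn by (intro mult_right_mono) auto
        also have "\<dots> \<le> L / 2 * (1 * D n)"
          using L(1) D0[of n] tn by (intro mult_left_mono mult_right_mono) auto
        also have "\<dots> \<le> L / 2 * ((1 + \<theta>) * M n + c)"
          using L(1) D[of n] by (intro mult_left_mono) auto
        also have "\<dots> = L / 2 * (1 + \<theta>) * M n + L * c / 2"
          by (simp add: field_simps)
        finally have 1: "- l / 2 * ((1 - t n) * D n) \<le> L / 2 * (1 + \<theta>) * M n + L * c / 2" .
        have 2: "b * M n \<le> (a - L / 2 * (1 + \<theta>)) * M n"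
          using M0[of n] by (intro mult_right_mono) (simp_all add: b_def)
        have "(L * c + 1) \<le> real n" using N that by linarith
        then have 3: "real (Suc n) / 2 \<le> real n - L * c / 2" by simp
        have 4: "b * real (Suc n) \<le> real (Suc n) / 2"
        proof -
          have "b \<le> 1 / 2" unfolding b_def by (rule min.cobounded2)
          then show ?thesis using mult_right_mono[of b "1 / 2" "real (Suc n)"] by simp
        qed
        \<comment> \<open>With \<open>u = n + 1\<close> and \<open>v = 1 + M n\<close>, the slope is
          at most \<open>- b * (u + v - 1)\<close> and the time is \<open>1 / sqrt (u * v)\<close>;
          this bound makes their product at most \<open>- b\<close>.\<close>
        have 5: "sqrt (real (Suc n) * (1 + M n)) \<le> real (Suc n) + M n"
        proof (rule real_le_lsqrt)
          have "0 \<le> real n * real (Suc n) + M n * real (Suc n) + M n * M n"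
            using M0[of n] by (intro add_nonneg_nonneg mult_nonneg_nonneg) auto
          then show "real (Suc n) * (1 + M n) \<le> (real (Suc n) + M n)\<^sup>2"
            by (simp add: power2_eq_square algebra_simps)
        qed (use M0[of n] in auto)
        have "g - l / 2 * ((1 - t n) * D n) \<le> - b * (real (Suc n) + M n)"
        proof -
          have "(a - L / 2 * (1 + \<theta>)) * M n = a * M n - L / 2 * (1 + \<theta>) * M n"
            "- l / 2 * ((1 - t n) * D n) = - (l / 2 * ((1 - t n) * D n))"
            "- b * (real (Suc n) + M n) = - (b * real (Suc n)) - b * M n"
            by (simp_all add: left_diff_distrib distrib_left)
          then show ?thesis using g(2) 1 2 3 4 by linarith
        qed
        also have "\<dots> \<le> - b * sqrt (real (Suc n) * (1 + M n))"
          using 5 b by simp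
        finally have "t n * (g - l / 2 * ((1 - t n) * D n)) \<le> t n * (- b * sqrt (real (Suc n) * (1 + M n)))"
          using t(1)[of n] by (intro mult_left_mono) auto
        also have "\<dots> = - b" using M0[of n] by (simp add: t_def)
        finally show ?thesis by (simp add: algebra_simps)
      qed
      finally show ?thesis by simp
    qed
    then show "\<forall>\<^sub>F n in sequentially. F (\<sigma> n) \<le> ereal ((1 - t n) * f - b)"
      unfolding eventually_sequentially by blast
  qed
  also have "\<dots> = ereal ((1 - 0) * f - b)"
  proof (rule lim_imp_Liminf)
    have "t \<longlonglongrightarrow> 0"
    proof (rule tendsto_sandwich[OF _ _ tendsto_const])
      have "(\<lambda>n. 1 / sqrt (real n)) \<longlonglongrightarrow> 0"
        using tendsto_real_sqrt[OF lim_1_over_n] by (simp add: real_sqrt_divide)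
      then show "(\<lambda>n. 1 / sqrt (real (Suc n))) \<longlonglongrightarrow> 0" by (rule LIMSEQ_Suc)
    qed (use t(1,4) in \<open>auto intro!: always_eventually less_imp_le\<close>)
    then show "(\<lambda>n. ereal ((1 - t n) * f - b)) \<longlonglongrightarrow> ereal ((1 - 0) * f - b)"
      by (intro tendsto_ereal tendsto_intros)
  qed simp
  finally show False using f b by simp
qed

text \<open>The weight \<open>w\<close> is abstract because it will contain a negative multiple of
  the second moment, and nonnegativity of the whole is what Fatou's lemma needs. Coercivity is asked
  of the cost and \<open>F\<close> together, as \<open>F\<close> alone may tend to
  \<open>-\<infinity>\<close>. The entropy bound then gives compactness, and the moment bound keeps
  the limit in \<open>P2\<close>.\<close>

lemma entropic_plan_minimizer:
  fixes F :: "'a::euclidean_space measure \<Rightarrow> ereal" and w :: "'a \<times> 'a \<Rightarrow> real"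
  defines "\<Psi> \<equiv> \<lambda>\<delta> \<alpha> \<gamma> \<rho>. ereal (\<integral>z. w z \<partial>\<gamma>) + (ereal \<alpha> * dual_entropy (gauss_ref \<delta>) \<gamma> + F \<rho>)"
  assumes F: "\<And>\<rho>. \<rho> \<in> P2 \<Longrightarrow> F \<rho> \<noteq> -\<infinity>" and lsc: "lsc_narrow_bounded_moments F"
    and \<mu>: "\<mu> \<in> P2" and pos: "\<delta> > 0" "\<alpha> > 0" "e > 0"
    and w: "continuous_on UNIV w" "\<And>z. 0 \<le> w z"
    and wint: "\<And>\<rho> \<gamma>. \<rho> \<in> P2 \<Longrightarrow> \<gamma> \<in> couplings \<mu> \<rho> \<Longrightarrow> integrable \<gamma> w"
    and coercive: "\<And>\<rho> \<gamma>. \<rho> \<in> P2 \<Longrightarrow> \<gamma> \<in> couplings \<mu> \<rho> \<Longrightarrow>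
      ereal (e * (\<integral>x. (norm x)\<^sup>2 \<partial>\<rho>) - C) \<le> ereal (\<integral>z. w z \<partial>\<gamma>) + F \<rho>"
    and proper: "\<rho>0 \<in> P2" "\<gamma>0 \<in> couplings \<mu> \<rho>0" "dual_entropy (gauss_ref \<delta>) \<gamma>0 < \<infinity>" "F \<rho>0 < \<infinity>"
  shows "\<exists>\<rho> \<in> P2. \<exists>\<gamma> \<in> couplings \<mu> \<rho>. \<bar>\<Psi> \<delta> \<alpha> \<gamma> \<rho>\<bar> \<noteq> \<infinity> \<and>
    (\<forall>\<rho>' \<in> P2. \<forall>\<gamma>' \<in> couplings \<mu> \<rho>'. \<Psi> \<delta> \<alpha> \<gamma> \<rho> \<le> \<Psi> \<delta> \<alpha> \<gamma>' \<rho>')"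
proof -
  let ?E = "dual_entropy (gauss_ref \<delta> :: ('a \<times> 'a) measure)"
  let ?M = "\<lambda>\<rho> :: 'a measure. (\<integral>x. (norm x)\<^sup>2 \<partial>\<rho>)"
  have lower: "ereal (e * ?M \<rho> - C) + ereal \<alpha> * ?E \<gamma> \<le> \<Psi> \<delta> \<alpha> \<gamma> \<rho>"
    if "\<rho> \<in> P2" "\<gamma> \<in> couplings \<mu> \<rho>" for \<rho> \<gamma>
  proof -
    have "ereal (e * ?M \<rho> - C) + ereal \<alpha> * ?E \<gamma> \<le> (ereal (\<integral>z. w z \<partial>\<gamma>) + F \<rho>) + ereal \<alpha> * ?E \<gamma>"
      by (intro add_right_mono coercive that)
    then show ?thesis by (simp add: \<Psi>_def ac_simps)
  qed
  have \<alpha>E: "0 \<le> ereal \<alpha> * ?E \<gamma>" for \<gamma>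
    by (rule ereal_0_le_mult) (use pos dual_entropy_nonneg in \<open>auto simp: less_imp_le\<close>)
  have M0: "0 \<le> ?M \<rho>" for \<rho> by (auto intro!: integral_nonneg_AE)
  define S where "S = {(\<gamma>, \<rho>). \<rho> \<in> P2 \<and> \<gamma> \<in> couplings \<mu> \<rho>}"
  define I where "I = (INF (\<gamma>, \<rho>) \<in> S. \<Psi> \<delta> \<alpha> \<gamma> \<rho>)"
  have I_le: "I \<le> \<Psi> \<delta> \<alpha> \<gamma> \<rho>" if "\<rho> \<in> P2" "\<gamma> \<in> couplings \<mu> \<rho>" for \<gamma> \<rho>
    unfolding I_def using that by (intro INF_lower2[of "(\<gamma>, \<rho>)"]) (auto simp: S_def)
  have "\<Psi> \<delta> \<alpha> \<gamma>0 \<rho>0 < \<infinity>"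
    using proper(3,4) pos dual_entropy_nonneg[of "gauss_ref \<delta>" \<gamma>0]
    by (cases "?E \<gamma>0"; cases "F \<rho>0") (auto simp: \<Psi>_def)
  then have "I < \<infinity>" using I_le[OF proper(1,2)] by (rule order_le_less_trans[rotated])
  moreover have "ereal (- C) \<le> I"
    unfolding I_def
  proof (rule INF_greatest, clarify)
    fix \<gamma> \<rho> assume "(\<gamma>, \<rho>) \<in> S"
    then have "\<rho> \<in> P2" "\<gamma> \<in> couplings \<mu> \<rho>" by (auto simp: S_def)
    have "ereal (- C) + 0 \<le> ereal (e * ?M \<rho> - C) + ereal \<alpha> * ?E \<gamma>"
      using M0[of \<rho>] pos \<alpha>E by (intro add_mono) auto
    also have "\<dots> \<le> \<Psi> \<delta> \<alpha> \<gamma> \<rho>" by (rule lower) fact+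
    finally show "ereal (- C) \<le> \<Psi> \<delta> \<alpha> \<gamma> \<rho>" by simp
  qed
  ultimately obtain i where i: "I = ereal i" by (cases I) auto
  have "\<exists>\<gamma> \<rho>. \<rho> \<in> P2 \<and> \<gamma> \<in> couplings \<mu> \<rho> \<and> \<Psi> \<delta> \<alpha> \<gamma> \<rho> < ereal (i + 1 / real (Suc n))" for n
  proof -
    have "(INF (\<gamma>, \<rho>) \<in> S. \<Psi> \<delta> \<alpha> \<gamma> \<rho>) < ereal (i + 1 / real (Suc n))"
      unfolding I_def[symmetric] i by simp
    then show ?thesis unfolding INF_less_iff by (auto simp: S_def)
  qed
  then obtain \<gamma> \<rho> where \<gamma>\<rho>: "\<And>n. \<rho> n \<in> P2" "\<And>n. \<gamma> n \<in> couplings \<mu> (\<rho> n)"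
    "\<And>n. \<Psi> \<delta> \<alpha> (\<gamma> n) (\<rho> n) < ereal (i + 1 / real (Suc n))"
    by metis
  note c = coupling_D[OF \<gamma>\<rho>(2)]
  have up: "ereal (e * ?M (\<rho> n) - C) + ereal \<alpha> * ?E (\<gamma> n) \<le> ereal (i + 1)" for n
  proof -
    have "ereal (e * ?M (\<rho> n) - C) + ereal \<alpha> * ?E (\<gamma> n) \<le> ereal (i + 1 / real (Suc n))"
      using lower[OF \<gamma>\<rho>(1,2)] \<gamma>\<rho>(3)[of n] by (meson less_imp_le order_trans)
    also have "\<dots> \<le> ereal (i + 1)" by simp
    finally show ?thesis .
  qed
  \<comment> \<open>\<open>B\<close> and \<open>K\<close> both come from \<open>up\<close>, by
    dropping the nonnegative entropy for the one and the nonnegative moment for the other.\<close>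
  define B where "B = (i + 1 + C) / e"
  have B: "?M (\<rho> n) \<le> B" for n
  proof -
    have "ereal (e * ?M (\<rho> n) - C) + 0 \<le> ereal (i + 1)"
      using \<alpha>E up[of n] by (meson add_left_mono order_trans)
    then show ?thesis using pos by (simp add: B_def field_simps)
  qed
  define K where "K = (i + 1 + C) / \<alpha>"
  have K: "?E (\<gamma> n) \<le> ereal K" for n
  proof -
    have "ereal (- C) + ereal \<alpha> * ?E (\<gamma> n) \<le> ereal (i + 1)"
      using M0[of "\<rho> n"] pos by (intro order_trans[OF add_right_mono up[of n]]) auto
    then show ?thesis using pos dual_entropy_nonneg[of "gauss_ref \<delta>" "\<gamma> n"]
      by (cases "?E (\<gamma> n)") (auto simp: K_def field_simps)
  qed
  note Q = finite_measure_gauss_ref[OF pos(1), where ?'a="'a \<times> 'a"] sets_gauss_ref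
  have uac: "\<exists>\<eta>>0. \<forall>A \<in> sets borel. measure (gauss_ref \<delta> :: ('a \<times> 'a) measure) A < \<eta> \<longrightarrow> (\<forall>n. measure (\<gamma> n) A \<le> \<epsilon>)"
    if "\<epsilon> > 0" for \<epsilon>
    using dual_entropy_uniformly_absolutely_continuous[OF Q that, of K] c(1,2) K by meson
  obtain r \<gamma>' where r: "strict_mono (r :: nat \<Rightarrow> nat)" and \<gamma>': "prob_space \<gamma>'" "sets \<gamma>' = sets borel"
    and conv: "setwise_converges (\<gamma> \<circ> r) \<gamma>'"
    using setwise_convergent_subsequence[OF Q c(1,2) uac] by metis
  interpret \<gamma>': prob_space \<gamma>' by fact
  have cr: "\<And>n. prob_space ((\<gamma> \<circ> r) n)" "\<And>n. sets ((\<gamma> \<circ> r) n) = sets borel" using c by auto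
  have sp: "space \<gamma>' = UNIV" using sets_eq_imp_space_eq[OF \<gamma>'(2)] by simp
  note ms = measurable_fst_snd_borel[OF c(2)] measurable_fst_snd_borel[OF \<gamma>'(2)]
  have lim: "(\<lambda>n. measure (\<gamma> (r n)) A) \<longlonglongrightarrow> measure \<gamma>' A" if "A \<in> sets borel" for A
    using conv that by (auto simp: setwise_converges_def)
  have vim: "fst -` A \<in> sets (borel :: ('a \<times> 'a) measure)" "snd -` A \<in> sets (borel :: ('a \<times> 'a) measure)"
    if "A \<in> sets borel" for A :: "'a set"
    using measurable_sets[OF measurable_fst_snd_borel(1)[OF refl] that]
      measurable_sets[OF measurable_fst_snd_borel(2)[OF refl] that] by simp_all
  define \<rho>' where "\<rho>' = distr \<gamma>' borel snd"
  interpret \<rho>': prob_space \<rho>' unfolding \<rho>'_def by (rule \<gamma>'.prob_space_distr[OF ms(4)])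
  have "distr \<gamma>' borel fst = \<mu>"
  proof (rule measure_eqI)
    interpret \<mu>: prob_space \<mu> by (rule P2_D[OF \<mu>])
    fix A assume "A \<in> sets (distr \<gamma>' borel fst)"
    then have A: "A \<in> sets borel" by simp
    have "measure (\<gamma> (r n)) (fst -` A) = measure \<mu> A" for n
      using measure_distr[OF ms(1) A, of "r n"] by (simp add: c(3,5))
    then have "measure \<gamma>' (fst -` A) = measure \<mu> A"
      using lim[OF vim(1)[OF A]] by (simp add: LIMSEQ_const_iff)
    then show "emeasure (distr \<gamma>' borel fst) A = emeasure \<mu> A"
      using A sp by (simp add: emeasure_distr[OF ms(3)] \<gamma>'.emeasure_eq_measure \<mu>.emeasure_eq_measure)
  qed (simp add: P2_D(2)[OF \<mu>])
  then have cpl: "\<gamma>' \<in> couplings \<mu> \<rho>'" using \<gamma>' by (simp add: couplings_def \<rho>'_def)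
  have convs: "setwise_converges (\<rho> \<circ> r) \<rho>'"
    unfolding setwise_converges_def
  proof
    fix A :: "'a set" assume A: "A \<in> sets borel"
    have "measure (\<rho> (r n)) A = measure (\<gamma> (r n)) (snd -` A)" for n
      using measure_distr[OF ms(2) A, of "r n"] by (simp add: c(4,5))
    moreover have "measure \<rho>' A = measure \<gamma>' (snd -` A)"
      using measure_distr[OF ms(4) A] sp by (simp add: \<rho>'_def)
    ultimately show "(\<lambda>n. measure ((\<rho> \<circ> r) n) A) \<longlonglongrightarrow> measure \<rho>' A"
      using lim[OF vim(2)[OF A]] by simp
  qed
  have pr: "\<And>n. prob_space ((\<rho> \<circ> r) n)" "\<And>n. sets ((\<rho> \<circ> r) n) = sets borel"
    using P2_D[OF \<gamma>\<rho>(1)] by auto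
  have s\<rho>': "sets \<rho>' = sets borel" by (simp add: \<rho>'_def)
  \<comment> \<open>Second moment may escape to infinity in the limit, so only the upper bound
    \<open>B\<close> is transferred.\<close>
  have \<rho>': "\<rho>' \<in> P2"
  proof (rule P2_I[OF \<rho>'.prob_space_axioms s\<rho>'])
    have "(\<integral>\<^sup>+x. ennreal ((norm x)\<^sup>2) \<partial>\<rho>') \<le> liminf (\<lambda>n. \<integral>\<^sup>+x. ennreal ((norm x)\<^sup>2) \<partial>(\<rho> \<circ> r) n)"
      by (rule setwise_Fatou[OF pr \<rho>'.prob_space_axioms s\<rho>' convs]) simp
    also have "\<dots> \<le> ennreal B"
    proof (rule order_trans[OF Liminf_le_Limsup Limsup_bounded])
      have "(\<integral>\<^sup>+x. ennreal ((norm x)\<^sup>2) \<partial>(\<rho> \<circ> r) n) = ennreal (?M (\<rho> (r n)))" for n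
        using P2_D(3)[OF \<gamma>\<rho>(1)] by (simp add: nn_integral_eq_integral)
      then show "\<forall>\<^sub>F n in sequentially. (\<integral>\<^sup>+x. ennreal ((norm x)\<^sup>2) \<partial>(\<rho> \<circ> r) n) \<le> ennreal B"
        using B by (simp add: ennreal_leI)
    qed simp_all
    finally have "(\<integral>\<^sup>+x. ennreal ((norm x)\<^sup>2) \<partial>\<rho>') < \<infinity>" by (rule order_le_less_trans) simp
    then show "integrable \<rho>' (\<lambda>x. (norm x)\<^sup>2)"
      by (intro integrableI_nonneg borel_measurable_continuous_sets[OF s\<rho>'] continuous_intros) auto
  qed
  have "narrowly_converges (\<rho> \<circ> r) \<rho>'"
    unfolding narrowly_converges_def
  proof (intro allI impI, elim conjE)
    fix f :: "'a \<Rightarrow> real" assume f: "continuous_on UNIV f" "bounded (range f)"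
    obtain b where b: "\<And>x. \<bar>f x\<bar> \<le> b" using f(2) by (auto simp: bounded_iff)
    show "(\<lambda>n. \<integral>x. f x \<partial>(\<rho> \<circ> r) n) \<longlonglongrightarrow> (\<integral>x. f x \<partial>\<rho>')"
      by (rule setwise_integral_tendsto[OF pr \<rho>'.prob_space_axioms s\<rho>' convs
            borel_measurable_continuous_onI[OF f(1)] b])
  qed
  then have F_lsc: "F \<rho>' \<le> liminf (\<lambda>n. F (\<rho> (r n)))"
    using lsc[unfolded lsc_narrow_bounded_moments_def, rule_format, of "\<rho> \<circ> r" \<rho>'] \<gamma>\<rho>(1) \<rho>' B by auto
  have E_lsc: "?E \<gamma>' \<le> liminf (\<lambda>n. ?E (\<gamma> (r n)))"
    using dual_entropy_lsc[OF cr \<gamma>' conv, of "gauss_ref \<delta>"] by simp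
  have w_lsc: "ereal (\<integral>z. w z \<partial>\<gamma>') \<le> liminf (\<lambda>n. ereal (\<integral>z. w z \<partial>\<gamma> (r n)))"
  proof -
    have eq: "enn2ereal (\<integral>\<^sup>+z. ennreal (w z) \<partial>\<eta>) = ereal (\<integral>z. w z \<partial>\<eta>)"
      if "\<sigma> \<in> P2" "\<eta> \<in> couplings \<mu> \<sigma>" for \<eta> \<sigma>
      using wint[OF that] w(2) by (subst nn_integral_eq_integral) (auto intro!: integral_nonneg_AE)
    have "(\<integral>\<^sup>+z. ennreal (w z) \<partial>\<gamma>') \<le> liminf (\<lambda>n. \<integral>\<^sup>+z. ennreal (w z) \<partial>(\<gamma> \<circ> r) n)"
      by (rule setwise_Fatou[OF cr \<gamma>' conv]) (use borel_measurable_continuous_onI[OF w(1)] in simp)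
    then have "enn2ereal (\<integral>\<^sup>+z. ennreal (w z) \<partial>\<gamma>') \<le> enn2ereal (liminf (\<lambda>n. \<integral>\<^sup>+z. ennreal (w z) \<partial>(\<gamma> \<circ> r) n))"
      by (simp add: less_eq_ennreal.rep_eq)
    also have "\<dots> = liminf (\<lambda>n. enn2ereal (\<integral>\<^sup>+z. ennreal (w z) \<partial>(\<gamma> \<circ> r) n))"
      by (simp add: liminf_enn2ereal)
    finally show ?thesis using eq[OF \<rho>' cpl] eq[OF \<gamma>\<rho>(1,2)] by simp
  qed
  have \<alpha>E_lsc: "ereal \<alpha> * ?E \<gamma>' \<le> liminf (\<lambda>n. ereal \<alpha> * ?E (\<gamma> (r n)))"
  proof -
    have "ereal \<alpha> * ?E \<gamma>' \<le> ereal \<alpha> * liminf (\<lambda>n. ?E (\<gamma> (r n)))"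
      using E_lsc pos by (intro ereal_mult_left_mono) auto
    also have "\<dots> = liminf (\<lambda>n. ereal \<alpha> * ?E (\<gamma> (r n)))"
      using pos by (intro Liminf_ereal_mult_left[symmetric]) auto
    finally show ?thesis .
  qed
  \<comment> \<open>Superadditivity of the lower limit in \<open>ereal\<close> requires excluding
    opposite infinities. The three terms are therefore added in two steps, with
    \<open>-\<infinity>\<close> ruled out for each lower limit.\<close>
  have lw: "liminf (\<lambda>n. ereal (\<integral>z. w z \<partial>\<gamma> (r n))) \<noteq> -\<infinity>" using w_lsc by auto
  have lE: "liminf (\<lambda>n. ereal \<alpha> * ?E (\<gamma> (r n))) \<noteq> -\<infinity>"
    using order_trans[OF \<alpha>E \<alpha>E_lsc] by auto
  have lF: "liminf (\<lambda>n. F (\<rho> (r n))) \<noteq> -\<infinity>" using F_lsc F[OF \<rho>'] by auto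
  have "ereal \<alpha> * ?E \<gamma>' + F \<rho>' \<le> liminf (\<lambda>n. ereal \<alpha> * ?E (\<gamma> (r n))) + liminf (\<lambda>n. F (\<rho> (r n)))"
    by (intro add_mono \<alpha>E_lsc F_lsc)
  also have "\<dots> \<le> liminf (\<lambda>n. ereal \<alpha> * ?E (\<gamma> (r n)) + F (\<rho> (r n)))"
    using lE lF by (intro ereal_liminf_add_mono) auto
  finally have EF: "ereal \<alpha> * ?E \<gamma>' + F \<rho>' \<le> liminf (\<lambda>n. ereal \<alpha> * ?E (\<gamma> (r n)) + F (\<rho> (r n)))" .
  have lEF: "liminf (\<lambda>n. ereal \<alpha> * ?E (\<gamma> (r n)) + F (\<rho> (r n))) \<noteq> -\<infinity>"
    using EF \<alpha>E[of \<gamma>'] F[OF \<rho>'] by (cases "ereal \<alpha> * ?E \<gamma>'"; cases "F \<rho>'") auto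
  have "\<Psi> \<delta> \<alpha> \<gamma>' \<rho>' \<le> liminf (\<lambda>n. ereal (\<integral>z. w z \<partial>\<gamma> (r n))) + liminf (\<lambda>n. ereal \<alpha> * ?E (\<gamma> (r n)) + F (\<rho> (r n)))"
    unfolding \<Psi>_def by (intro add_mono w_lsc EF)
  also have "\<dots> \<le> liminf (\<lambda>n. \<Psi> \<delta> \<alpha> (\<gamma> (r n)) (\<rho> (r n)))"
    unfolding \<Psi>_def using lw lEF by (intro ereal_liminf_add_mono) auto
  also have "\<dots> \<le> liminf (\<lambda>n. ereal (i + 1 / real (Suc n)))"
  proof (intro Liminf_mono always_eventually allI)
    fix n
    have "1 / real (Suc (r n)) \<le> 1 / real (Suc n)"
      using seq_suble[OF r, of n] by (intro divide_left_mono) auto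
    then have "ereal (i + 1 / real (Suc (r n))) \<le> ereal (i + 1 / real (Suc n))" by simp
    then show "\<Psi> \<delta> \<alpha> (\<gamma> (r n)) (\<rho> (r n)) \<le> ereal (i + 1 / real (Suc n))"
      using \<gamma>\<rho>(3)[of "r n"] by (meson less_imp_le order_trans)
  qed
  also have "\<dots> = ereal (i + 0)"
    by (intro lim_imp_Liminf tendsto_ereal tendsto_add tendsto_const LIMSEQ_Suc[OF lim_1_over_n]) simp
  finally have min: "\<Psi> \<delta> \<alpha> \<gamma>' \<rho>' \<le> I" by (simp add: i)
  show ?thesis
  proof (intro bexI[OF _ \<rho>'] bexI[OF _ cpl] conjI ballI)
    show "\<bar>\<Psi> \<delta> \<alpha> \<gamma>' \<rho>'\<bar> \<noteq> \<infinity>" using antisym[OF min I_le[OF \<rho>' cpl]] i by simp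
    show "\<Psi> \<delta> \<alpha> \<gamma>' \<rho>' \<le> \<Psi> \<delta> \<alpha> \<gamma>'' \<rho>''" if "\<rho>'' \<in> P2" "\<gamma>'' \<in> couplings \<mu> \<rho>''" for \<gamma>'' \<rho>''
      using order_trans[OF min I_le[OF that]] .
  qed
qed


section \<open>From the plan problem back to the Schroedinger functional\<close>

theorem theorem2p33:
  fixes F :: "(real ^ 'd) measure \<Rightarrow> ereal" and l \<alpha> \<tau> :: real
  assumes "\<forall>\<rho> \<in> P2. F \<rho> \<noteq> -\<infinity>"
    and "convex_along_generalized_geodesics l F"
    and "lsc_narrow_bounded_moments F"
    and "\<alpha> > 0"
    and "0 < \<tau>" and "ereal \<tau> < 1 / ereal (max (- l) 0)"
    and "\<exists>\<nu>\<^sub>0 \<in> P2. \<bar>F \<nu>\<^sub>0\<bar> \<noteq> \<infinity> \<and> \<bar>boltzmann_entropy \<nu>\<^sub>0\<bar> \<noteq> \<infinity>"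
  shows "\<forall>\<mu> \<in> P2. \<bar>boltzmann_entropy \<mu>\<bar> \<noteq> \<infinity> \<longrightarrow>
    (\<exists>J \<in> P2.
       (\<forall>\<rho> \<in> P2. schroedinger_cost (\<alpha> * \<tau>) \<mu> J / ereal \<tau> + F J
                   \<le> schroedinger_cost (\<alpha> * \<tau>) \<mu> \<rho> / ereal \<tau> + F \<rho>) \<and>
       \<bar>boltzmann_entropy J\<bar> \<noteq> \<infinity>)"
proof (intro ballI impI)
  fix \<mu> :: "(real ^ 'd) measure"
  assume \<mu>: "\<mu> \<in> P2" and H\<mu>: "\<bar>boltzmann_entropy \<mu>\<bar> \<noteq> \<infinity>"
  have F: "\<And>\<rho>. \<rho> \<in> P2 \<Longrightarrow> F \<rho> \<noteq> -\<infinity>" using assms(1) by blast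
  obtain \<nu> where \<nu>: "\<nu> \<in> P2" "\<bar>F \<nu>\<bar> \<noteq> \<infinity>" "\<bar>boltzmann_entropy \<nu>\<bar> \<noteq> \<infinity>"
    using assms(7) by (elim bexE conjE) (rule that)
  define L where "L = max (- l) 0"
  \<comment> \<open>\<open>k\<close> is the coefficient of the squared distance after division by
    \<open>\<tau>\<close>. Its gap to \<open>L / 2\<close> is split into four parts
    \<open>e\<close>: for the Gaussian correction (\<open>\<alpha> * \<delta> = e\<close>), for
    Young's inequality (\<open>k * \<theta> = e\<close>), for the slack in the lower bound of
    \<open>F\<close>, and for coercivity.\<close>
  define k where "k = 1 / (2 * \<tau>)"
  define e where "e = (k - L / 2) / 4"
  define \<delta> where "\<delta> = e / \<alpha>"
  define \<theta> where "\<theta> = e / k"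
  have L: "L \<ge> 0" by (simp add: L_def)
  have k: "k > 0" using assms(5) by (simp add: k_def)
  \<comment> \<open>For \<open>L = 0\<close> the hypothesis reads
    \<open>\<tau> < \<infinity>\<close> in \<open>ereal\<close>, and the claim is just
    \<open>k > 0\<close>; otherwise it says \<open>\<tau> * L < 1\<close>.\<close>
  have "L / 2 < k"
  proof (cases "L = 0")
    case False
    then have "\<tau> < 1 / L" using assms(6) L unfolding L_def[symmetric] by (simp add: one_ereal_def)
    then have "\<tau> * L < 1" using False L by (simp add: field_simps)
    then show ?thesis using assms(5) by (simp add: k_def field_simps)
  qed (use k in simp)
  then have e: "e > 0" by (simp add: e_def)
  have \<delta>: "\<delta> > 0" "\<alpha> * \<delta> = e" using e assms(4) by (simp_all add: \<delta>_def)
  have \<theta>: "\<theta> > 0" "k * \<theta> = e" using e k by (simp_all add: \<theta>_def)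
  let ?Q = "gauss_ref \<delta> :: (real ^ 'd) measure"
  let ?QQ = "gauss_ref \<delta> :: ((real ^ 'd) \<times> (real ^ 'd)) measure"
  let ?M = "\<lambda>\<rho> :: (real ^ 'd) measure. (\<integral>x. (norm x)\<^sup>2 \<partial>\<rho>)"
  obtain C where C: "\<And>\<rho>. \<rho> \<in> P2 \<Longrightarrow> ereal (- (L / 2 + e) * ?M \<rho> - C) \<le> F \<rho>"
    using quadratic_lower_bound[OF F assms(2,3) \<nu>(1,2), of "L / 2 + e"] e by (auto simp: L_def)
  \<comment> \<open>Besides the cost, \<open>w\<close> carries the second-marginal moment borrowed
    from the entropy. The term in \<open>fst z\<close> has constant integral because
    \<open>\<mu>\<close> is fixed, and is there to make \<open>w\<close> nonnegative.\<close>
  define w :: "(real ^ 'd) \<times> (real ^ 'd) \<Rightarrow> real" where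
    "w z = k * (norm (fst z - snd z))\<^sup>2 - e * (norm (snd z))\<^sup>2 + k / \<theta> * (norm (fst z))\<^sup>2" for z
  have wc: "continuous_on UNIV w" unfolding w_def by (intro continuous_intros)
  have w_lower: "(k - 2 * e) * (norm (snd z))\<^sup>2 \<le> w z" for z
  proof -
    have "k * ((1 - \<theta>) * (norm (snd z))\<^sup>2 - (1 / \<theta> - 1) * (norm (fst z))\<^sup>2) \<le> k * (norm (fst z - snd z))\<^sup>2"
      using norm_diff_power2_le_eps(2)[OF \<theta>(1)] k by (intro mult_left_mono) auto
    moreover have "k * ((1 - \<theta>) * (norm (snd z))\<^sup>2 - (1 / \<theta> - 1) * (norm (fst z))\<^sup>2)
        = k * (norm (snd z))\<^sup>2 - e * (norm (snd z))\<^sup>2 - k / \<theta> * (norm (fst z))\<^sup>2 + k * (norm (fst z))\<^sup>2"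
      unfolding \<theta>(2)[symmetric] by (simp add: algebra_simps)
    moreover have "(k - 2 * e) * (norm (snd z))\<^sup>2 = k * (norm (snd z))\<^sup>2 - 2 * (e * (norm (snd z))\<^sup>2)"
      by (simp add: left_diff_distrib)
    moreover have "0 \<le> k * (norm (fst z))\<^sup>2" using k by simp
    ultimately show ?thesis unfolding w_def by linarith
  qed
  have "4 * e = k - L / 2" by (simp add: e_def)
  then have ke: "k - 2 * e \<ge> 0" "k - 2 * e - (L / 2 + e) = e" using L e by linarith+
  have w0: "0 \<le> w z" for z using order_trans[OF _ w_lower] ke by simp
  have wint: "integrable \<gamma> w"
    and wval: "(\<integral>z. w z \<partial>\<gamma>) = k * (\<integral>z. (norm (fst z - snd z))\<^sup>2 \<partial>\<gamma>) - e * ?M \<rho> + k / \<theta> * ?M \<mu>"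
    and wcoerc: "ereal (e * ?M \<rho> - C) \<le> ereal (\<integral>z. w z \<partial>\<gamma>) + F \<rho>"
    if \<rho>: "\<rho> \<in> P2" and \<gamma>: "\<gamma> \<in> couplings \<mu> \<rho>" for \<rho> \<gamma>
  proof -
    note i = coupling_P2[OF \<gamma> \<mu> \<rho>]
    show wi: "integrable \<gamma> w" unfolding w_def using i by simp
    show "(\<integral>z. w z \<partial>\<gamma>) = k * (\<integral>z. (norm (fst z - snd z))\<^sup>2 \<partial>\<gamma>) - e * ?M \<rho> + k / \<theta> * ?M \<mu>"
      unfolding w_def using i by simp
    have "(\<integral>z. (k - 2 * e) * (norm (snd z))\<^sup>2 \<partial>\<gamma>) \<le> (\<integral>z. w z \<partial>\<gamma>)"
      using i wi w_lower by (intro integral_mono) auto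
    then have "(k - 2 * e) * ?M \<rho> \<le> (\<integral>z. w z \<partial>\<gamma>)" using i by simp
    then have "ereal ((k - 2 * e) * ?M \<rho>) + ereal (- (L / 2 + e) * ?M \<rho> - C) \<le> ereal (\<integral>z. w z \<partial>\<gamma>) + F \<rho>"
      using C[OF \<rho>] by (intro add_mono) auto
    moreover have "(k - 2 * e) * ?M \<rho> + (- (L / 2 + e) * ?M \<rho> - C) = (k - 2 * e - (L / 2 + e)) * ?M \<rho> - C"
      by (simp add: algebra_simps)
    ultimately show "ereal (e * ?M \<rho> - C) \<le> ereal (\<integral>z. w z \<partial>\<gamma>) + F \<rho>"
      unfolding ke(2) plus_ereal.simps by (simp only:)
  qed
  have QQ: "?Q \<Otimes>\<^sub>M ?Q = ?QQ" by (rule gauss_ref_pair[OF \<delta>(1)])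
  note fQ = finite_measure_gauss_ref[OF \<delta>(1)]
  have pair_fin: "dual_entropy ?QQ (\<mu> \<Otimes>\<^sub>M \<nu>) < \<infinity>"
    unfolding QQ[symmetric]
    by (rule dual_entropy_pair_finite[OF fQ sets_gauss_ref fQ sets_gauss_ref])
      (use P2_D[OF \<mu>] P2_D[OF \<nu>(1)] H\<mu> \<nu>(3) finite_boltzmann_entropy_iff[OF \<delta>(1) \<mu>]
        finite_boltzmann_entropy_iff[OF \<delta>(1) \<nu>(1)] in auto)
  define \<Psi> where "\<Psi> \<gamma> \<rho> = ereal (\<integral>z. w z \<partial>\<gamma>) + (ereal \<alpha> * dual_entropy ?QQ \<gamma> + F \<rho>)" for \<gamma> \<rho>
  have "F \<nu> < \<infinity>" using \<nu>(2) by auto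
  have "\<exists>J \<in> P2. \<exists>\<gamma> \<in> couplings \<mu> J. \<bar>\<Psi> \<gamma> J\<bar> \<noteq> \<infinity> \<and>
      (\<forall>\<rho>' \<in> P2. \<forall>\<gamma>' \<in> couplings \<mu> \<rho>'. \<Psi> \<gamma> J \<le> \<Psi> \<gamma>' \<rho>')"
    unfolding \<Psi>_def
    by (rule entropic_plan_minimizer[where e=e and C=C, OF F assms(3) \<mu> \<delta>(1) assms(4) e wc w0 _ _
          \<nu>(1) pair_coupling[OF \<mu> \<nu>(1)] pair_fin \<open>F \<nu> < \<infinity>\<close>])
      (assumption | erule (1) wint wcoerc)+
  then obtain J \<gamma> where J: "J \<in> P2" and \<gamma>: "\<gamma> \<in> couplings \<mu> J" and \<Psi>fin: "\<bar>\<Psi> \<gamma> J\<bar> \<noteq> \<infinity>"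
    and "\<forall>\<rho>' \<in> P2. \<forall>\<gamma>' \<in> couplings \<mu> \<rho>'. \<Psi> \<gamma> J \<le> \<Psi> \<gamma>' \<rho>'"
    by (elim bexE conjE) (rule that)
  then have min: "\<Psi> \<gamma> J \<le> \<Psi> \<gamma>' \<rho>'" if "\<rho>' \<in> P2" "\<gamma>' \<in> couplings \<mu> \<rho>'" for \<rho>' \<gamma>'
    using that by simp
  define Sp where "Sp \<gamma> = ereal (\<integral>(x, y). (norm (x - y))\<^sup>2 / 2 \<partial>\<gamma>) + ereal (\<alpha> * \<tau>) * boltzmann_entropy \<gamma>
        + ereal (\<alpha> * \<tau> * real DIM(real ^ 'd) / 2 * ln (2 * pi * (\<alpha> * \<tau>)))" for \<gamma> :: "((real ^ 'd) \<times> (real ^ 'd)) measure"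
  \<comment> \<open>Collects what does not vary with the plan: the mass of the Gaussian, the first
    marginal's share of the borrowed moment, the term added to \<open>w\<close>, and the
    normalisation of the Schroedinger cost.\<close>
  define K where "K = \<alpha> * (1 - measure ?QQ UNIV) - (e + k / \<theta>) * ?M \<mu>
        + \<alpha> * real DIM(real ^ 'd) / 2 * ln (2 * pi * (\<alpha> * \<tau>))"
  have Sch: "schroedinger_cost (\<alpha> * \<tau>) \<mu> \<rho> = (INF \<gamma> \<in> couplings \<mu> \<rho>. Sp \<gamma>)" for \<rho>
    by (simp add: schroedinger_cost_def Sp_def)
  \<comment> \<open>The two objectives differ by a constant even at infinite values, since the dual
    entropy is nonnegative and \<open>F\<close> avoids \<open>-\<infinity>\<close>.\<close>
  have Sp: "Sp \<gamma>' / ereal \<tau> + F \<rho>' = \<Psi> \<gamma>' \<rho>' + ereal K" if \<rho>': "\<rho>' \<in> P2" and \<gamma>': "\<gamma>' \<in> couplings \<mu> \<rho>'" for \<gamma>' \<rho>'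
  proof -
    note i = coupling_P2[OF \<gamma>' \<mu> \<rho>']
    note H = boltzmann_entropy_eq_dual_entropy[OF \<delta>(1) i(1), unfolded i(6)]
    define D where "D = (\<integral>z. (norm (fst z - snd z))\<^sup>2 \<partial>\<gamma>')"
    have cost: "(\<integral>(x, y). (norm (x - y))\<^sup>2 / 2 \<partial>\<gamma>') = D / 2" by (simp add: split_beta' D_def)
    show ?thesis
    proof (cases "dual_entropy ?QQ \<gamma>'")
      case (real E)
      define Z where "Z = measure ?QQ UNIV"
      define q where "q = real DIM(real ^ 'd) / 2 * ln (2 * pi * (\<alpha> * \<tau>))"
      have "Sp \<gamma>' = ereal (D / 2 + \<alpha> * \<tau> * (E + (1 - (Z + \<delta> * (?M \<mu> + ?M \<rho>')))) + \<alpha> * \<tau> * q)"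
        unfolding Sp_def H cost real by (simp add: Z_def q_def)
      moreover have "(D / 2 + \<alpha> * \<tau> * (E + (1 - (Z + \<delta> * (?M \<mu> + ?M \<rho>')))) + \<alpha> * \<tau> * q) / \<tau>
          = k * D + \<alpha> * (E + (1 - Z)) - (\<alpha> * \<delta>) * (?M \<mu> + ?M \<rho>') + \<alpha> * q"
        using assms(5) by (simp add: k_def field_simps)
      ultimately have S: "Sp \<gamma>' / ereal \<tau> = ereal (k * D + \<alpha> * (E + (1 - Z)) - e * (?M \<mu> + ?M \<rho>') + \<alpha> * q)"
        using assms(5) \<delta>(2) by simp
      have K: "K = \<alpha> * (1 - Z) - (e + k / \<theta>) * ?M \<mu> + \<alpha> * q" by (simp add: K_def Z_def q_def)
      have "\<Psi> \<gamma>' \<rho>' + ereal K = ereal (k * D - e * ?M \<rho>' + k / \<theta> * ?M \<mu> + \<alpha> * E + K) + F \<rho>'"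
        unfolding \<Psi>_def wval[OF \<rho>' \<gamma>'] D_def[symmetric] real using F[OF \<rho>'] by (cases "F \<rho>'") auto
      also have "k * D - e * ?M \<rho>' + k / \<theta> * ?M \<mu> + \<alpha> * E + K
          = k * D + \<alpha> * (E + (1 - Z)) - e * (?M \<mu> + ?M \<rho>') + \<alpha> * q"
        unfolding K by (simp add: algebra_simps)
      finally show ?thesis unfolding S by simp
    next
      case PInf
      then have "Sp \<gamma>' = \<infinity>" unfolding Sp_def H using assms(4,5) by simp
      moreover have "\<Psi> \<gamma>' \<rho>' = \<infinity>" unfolding \<Psi>_def PInf using assms(4) F[OF \<rho>'] by simp
      ultimately show ?thesis using assms(5) F[OF \<rho>'] by simp
    next
      case MInf
      then show ?thesis using dual_entropy_nonneg[of ?QQ \<gamma>'] by simp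
    qed
  qed
  obtain R where R: "\<Psi> \<gamma> J + ereal K = ereal R" using \<Psi>fin by (cases "\<Psi> \<gamma> J") auto
  \<comment> \<open>A finite value of \<open>\<Psi>\<close> forces finite entropy of the plan,
    because the remaining terms are never \<open>-\<infinity>\<close>. Factoring \<open>?QQ\<close>
    into Gaussians passes this on to the second marginal.\<close>
  have HJ: "\<bar>boltzmann_entropy J\<bar> \<noteq> \<infinity>"
  proof -
    have "dual_entropy ?QQ \<gamma> < \<infinity>"
      using \<Psi>fin assms(4) F[OF J] by (cases "dual_entropy ?QQ \<gamma>"; cases "F J") (auto simp: \<Psi>_def)
    then have "dual_entropy ?Q (distr \<gamma> borel snd) < \<infinity>"
      using coupling_D(1,2)[OF \<gamma>] unfolding QQ[symmetric]
      by (intro dual_entropy_snd_finite[OF fQ sets_gauss_ref measure_gauss_ref_pos[OF \<delta>(1)] fQ sets_gauss_ref])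
    then show ?thesis
      using finite_boltzmann_entropy_iff[OF \<delta>(1) J] coupling_D(4)[OF \<gamma>] by simp
  qed
  have opt: "schroedinger_cost (\<alpha> * \<tau>) \<mu> J / ereal \<tau> + F J \<le> schroedinger_cost (\<alpha> * \<tau>) \<mu> \<rho> / ereal \<tau> + F \<rho>"
    if \<rho>: "\<rho> \<in> P2" for \<rho>
  proof -
    have "schroedinger_cost (\<alpha> * \<tau>) \<mu> J / ereal \<tau> + F J \<le> Sp \<gamma> / ereal \<tau> + F J"
      unfolding Sch using assms(5) by (intro add_right_mono ereal_divide_right_mono INF_lower \<gamma>) auto
    also have "\<dots> = ereal R" using Sp[OF J \<gamma>] R by simp
    also have "\<dots> \<le> schroedinger_cost (\<alpha> * \<tau>) \<mu> \<rho> / ereal \<tau> + F \<rho>"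
    \<comment> \<open>For finite \<open>F \<rho>\<close> the inequality is solved for
      \<open>Sp\<close>, so that the infimum is bounded below plan by plan. For
      \<open>F \<rho> = \<infinity>\<close> the right side is infinite, as in \<open>ereal\<close>
      anything plus \<open>\<infinity>\<close> is \<open>\<infinity>\<close>.\<close>
    proof (cases "F \<rho>")
      case (real f)
      have "ereal (\<tau> * (R - f)) \<le> schroedinger_cost (\<alpha> * \<tau>) \<mu> \<rho>"
        unfolding Sch
      proof (rule INF_greatest)
        fix \<gamma>' assume \<gamma>': "\<gamma>' \<in> couplings \<mu> \<rho>"
        have "\<Psi> \<gamma> J + ereal K \<le> \<Psi> \<gamma>' \<rho> + ereal K" by (intro add_right_mono min \<rho> \<gamma>')
        then have "ereal R \<le> Sp \<gamma>' / ereal \<tau> + ereal f" using Sp[OF \<rho> \<gamma>'] R real by simp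
        then show "ereal (\<tau> * (R - f)) \<le> Sp \<gamma>'"
          using assms(5) by (cases "Sp \<gamma>'") (auto simp: field_simps)
      qed
      then show ?thesis
        using assms(5) real by (cases "schroedinger_cost (\<alpha> * \<tau>) \<mu> \<rho>") (auto simp: field_simps)
    qed (use F[OF \<rho>] in auto)
    finally show ?thesis .
  qed
  show "\<exists>J \<in> P2. (\<forall>\<rho> \<in> P2. schroedinger_cost (\<alpha> * \<tau>) \<mu> J / ereal \<tau> + F J
      \<le> schroedinger_cost (\<alpha> * \<tau>) \<mu> \<rho> / ereal \<tau> + F \<rho>) \<and> \<bar>boltzmann_entropy J\<bar> \<noteq> \<infinity>"
    by (intro bexI[OF _ J] conjI ballI opt HJ)
qed

end
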